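(* Assume (A1) and (A2). There is an absolute constant $c$ such that if $n\ge c\,\bar\kappa^2r^2\log k/\tau^2$, then with high probability the maximizer $x_{\mathrm{MLE}}$ of $f$ over $\Delta_R$ satisfies $$\|\hat A x_{\mathrm{MLE}}-\hat A x^*\|_1\le\widetilde O\big(\sqrt{r/n}\big)\quad\text{and}\quad \|x_{\mathrm{MLE}}-x^*\|_1\le\widetilde O\big(\bar\kappa\sqrt{r/n}\big).$$
   Context: $A\in\mathbb{R}^{D\times k}$ is a word-topic matrix (nonnegative entries, columns summing to $1$). $x^*\in\{z\in\mathbb{R}^k_{\ge0}:\sum z_i=1\}$; a document of $n$ words $w_1,\dots,w_n$ is drawn i.i.d. from the categorical distribution on $[D]$ with probabilities $Ax^*$. Assumption (A1): $R=\mathrm{supp}(x^* )$ has $|R|\le r$ and $x^*_i\ge\tau/r$ for all $i\in R$, where $\tau\in(0,1]$. Assumption (A2): for every $r$-sparse $v\in\mathbb{R}^k$, $\|Av\|_1\ge\|v\|_1/\bar\kappa$. Vectors supported on $R$ are identified with vectors in $\mathbb{R}^R$; in particular $x^*\in\mathbb{R}^R$. $\hat A\in\mathbb{R}^{D\times R}$ is the submatrix of $A$ with columns in $R$, and $\hat a_w\in\mathbb{R}^R$ is its $w$-th row. $\Delta_R=\{x\in\mathbb{R}^R_{\ge0}:\sum_i x_i=1\}$. The restricted log-likelihood is $f(x)=\sum_{t=1}^n\log\langle\hat a_{w_t},x\rangle$. "With high probability" means with probability $1-o(1)$ as $k\to\infty$, and $\widetilde O(\cdot)$ hides constant and polylogarithmic-in-$k$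 factors. *)

theory Defs
  imports "HOL-Probability.Probability"
begin

(* Conventions: topics are indexed by {..<k}, words by {..<D}.
   A w i = entry of the word-topic matrix (row w, column i).
   Vectors in R^k are functions nat => real (only indices < k matter). *)

definition supp_k :: "nat \<Rightarrow> (nat \<Rightarrow> real) \<Rightarrow> nat set" where
  "supp_k k x = {i \<in> {..<k}. x i \<noteq> 0}"

(* Delta_R, with vectors supported on R identified with vectors in R^R *)
definition simplex_on :: "nat set \<Rightarrow> (nat \<Rightarrow> real) set" where
  "simplex_on R = {x. (\<forall>i\<in>R. 0 \<le> x i) \<and> (\<forall>i. i \<notin> R \<longrightarrow> x i = 0) \<and> (\<Sum>i\<in>R. x i) = 1}"

definition rowdot :: "(nat \<Rightarrow> nat \<Rightarrow> real) \<Rightarrow> nat set \<Rightarrow> nat \<Rightarrow> (nat \<Rightarrow> real) \<Rightarrow> real" where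
  "rowdot A R w x = (\<Sum>i\<in>R. A w i * x i)"

definition loglik :: "(nat \<Rightarrow> nat \<Rightarrow> real) \<Rightarrow> nat set \<Rightarrow> nat \<Rightarrow> (nat \<Rightarrow> nat) \<Rightarrow> (nat \<Rightarrow> real) \<Rightarrow> real" where
  "loglik A R n ws x = (\<Sum>t<n. ln (rowdot A R (ws t) x))"

definition finite_loglik :: "(nat \<Rightarrow> nat \<Rightarrow> real) \<Rightarrow> nat set \<Rightarrow> nat \<Rightarrow> (nat \<Rightarrow> nat) \<Rightarrow> (nat \<Rightarrow> real) \<Rightarrow> bool" where
  "finite_loglik A R n ws x \<longleftrightarrow> (\<forall>t<n. 0 < rowdot A R (ws t) x)"

(* x is a maximizer of f over Delta_R (f takes value -infinity where some
   observed word has zero probability, so maximizers have finite f) *)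
definition is_MLE :: "(nat \<Rightarrow> nat \<Rightarrow> real) \<Rightarrow> nat set \<Rightarrow> nat \<Rightarrow> (nat \<Rightarrow> nat) \<Rightarrow> (nat \<Rightarrow> real) \<Rightarrow> bool" where
  "is_MLE A R n ws x \<longleftrightarrow> x \<in> simplex_on R \<and> finite_loglik A R n ws x \<and>
     (\<forall>y\<in>simplex_on R. finite_loglik A R n ws y \<longrightarrow> loglik A R n ws y \<le> loglik A R n ws x)"

definition word_pmf :: "nat \<Rightarrow> nat \<Rightarrow> (nat \<Rightarrow> nat \<Rightarrow> real) \<Rightarrow> (nat \<Rightarrow> real) \<Rightarrow> nat pmf" where
  "word_pmf k D A x = embed_pmf (\<lambda>w. if w < D then (\<Sum>i<k. A w i * x i) else 0)"

definition doc_pmf :: "nat \<Rightarrow> nat pmf \<Rightarrow> (nat \<Rightarrow> nat) pmf" where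
  "doc_pmf n p = Pi_pmf {..<n} 0 (\<lambda>_. p)"

definition l1_Av :: "nat \<Rightarrow> nat \<Rightarrow> (nat \<Rightarrow> nat \<Rightarrow> real) \<Rightarrow> (nat \<Rightarrow> real) \<Rightarrow> real" where
  "l1_Av k D A v = (\<Sum>w<D. \<bar>\<Sum>i<k. A w i * v i\<bar>)"

end

theory Submission
  imports Defs
begin

text \<open>
  Write \<open>p\<close> for the true word distribution, \<open>z\<close> for the relative deviation of the word distribution
  of \<open>xs + v\<close> from \<open>p\<close>, and \<open>H = E (z\<^sup>2 / (2 + z))\<close>. Cauchy-Schwarz bounds the \<open>L1\<close> error by
  \<open>sqrt (2 H)\<close>. If half the deviation of the maximizer had \<open>H > \<rho>\<^sup>2 \<sim> s ln k / n\<close>, where \<open>s\<close> is the size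
  of the support, then by concavity some deviation with \<open>H = \<rho>\<^sup>2\<close> exactly would be at least as likely as
  the truth. For one deviation, \<open>E (sqrt (1 + z)) \<le> 1 - H / 4\<close> gives a Chernoff bound \<open>exp (- n H / 8)\<close>.

  On the shell \<open>H = \<rho>\<^sup>2\<close> the lower bound on \<open>n\<close> and the sparse \<open>L1\<close> condition force \<open>\<bar>z\<bar> \<le> k\<close>, so the
  shell lies in an \<open>L2(p)\<close> ball of radius \<open>k \<rho>\<close> in dimension at most \<open>s\<close> and has a net of resolution
  \<open>\<rho> / poly(k)\<close> with \<open>exp (O(s ln k))\<close> points, whose size does not involve \<open>n\<close>. Between net
  points the log-likelihood is controlled by Markov's inequality for the empirical first and
  second moments of an \<open>L2(p)\<close>-orthonormal basis: the loss of a factor \<open>s ln k\<close> is absorbed by the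
  resolution of the net.
\<close>

section \<open>Orthonormal bases for a weighted inner product\<close>

text \<open>Gram-Schmidt, one function at a time. Dependent functions add no basis vector, so
  \<open>m\<close> may fall short of \<open>card I\<close>; positivity of \<open>p\<close> on
  \<open>S\<close> turns a residual of norm zero into one that vanishes on \<open>S\<close>.\<close>

lemma weighted_gram_schmidt:
  fixes p :: "'a \<Rightarrow> real" and g :: "'b \<Rightarrow> 'a \<Rightarrow> real"
  assumes "finite I" and S: "finite S" and p: "\<And>w. w \<in> S \<Longrightarrow> 0 < p w"
  shows "\<exists>m e. m \<le> card I \<and>
    (\<forall>i<m. \<forall>j<m. (\<Sum>w\<in>S. p w * (e i w * e j w)) = (if i = j then 1 else 0)) \<and>
    (\<forall>i\<in>I. \<exists>c. \<forall>w\<in>S. g i w = (\<Sum>j<(m::nat). c j * e j w))"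
  using \<open>finite I\<close>
proof (induction I rule: finite_induct)
  case empty
  show ?case by (intro exI[of _ 0]) auto
next
  case (insert x I)
  then obtain m e where m: "m \<le> card I"
    and on: "\<And>i j. i < m \<Longrightarrow> j < m \<Longrightarrow> (\<Sum>w\<in>S. p w * (e i w * e j w)) = (if i = j then 1 else 0)"
    and sp: "\<And>i. i \<in> I \<Longrightarrow> \<exists>c. \<forall>w\<in>S. g i w = (\<Sum>j<m. c j * e j w)"
    by (smt (verit))
  define c where "c j = (\<Sum>w\<in>S. p w * (g x w * e j w))" for j
  define h where "h w = g x w - (\<Sum>j<m. c j * e j w)" for w
  have gx: "g x w = (\<Sum>j<m. c j * e j w) + h w" for w by (simp add: h_def)
  have orth: "(\<Sum>w\<in>S. p w * (h w * e i w)) = 0" if i: "i < m" for i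
  proof -
    have "(\<Sum>w\<in>S. p w * (h w * e i w))
      = c i - (\<Sum>w\<in>S. \<Sum>j<m. c j * (p w * (e j w * e i w)))"
      by (simp add: h_def c_def algebra_simps sum_subtractf sum_distrib_left sum_distrib_right)
    also have "(\<Sum>w\<in>S. \<Sum>j<m. c j * (p w * (e j w * e i w)))
      = (\<Sum>j<m. c j * (\<Sum>w\<in>S. p w * (e j w * e i w)))"
      by (subst sum.swap) (simp add: sum_distrib_left)
    also have "\<dots> = (\<Sum>j<m. if j = i then c j else 0)"
      by (intro sum.cong refl) (simp add: on i)
    also have "\<dots> = c i" using i by simp
    finally show ?thesis by simp
  qed
  define N where "N = (\<Sum>w\<in>S. p w * (h w * h w))"
  have N0: "N \<ge> 0" unfolding N_def by (intro sum_nonneg mult_nonneg_nonneg[of "p _"]) (auto simp: p less_imp_le)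
  show ?case
  proof (cases "N = 0")
    case True
    have "p w * (h w * h w) = 0" if "w \<in> S" for w
      using True that unfolding N_def
      by (subst (asm) sum_nonneg_eq_0_iff) (auto simp: S less_imp_le p intro!: mult_nonneg_nonneg[of "p _"])
    then have h0: "h w = 0" if "w \<in> S" for w using p[OF that] that by fastforce
    have "\<exists>c. \<forall>w\<in>S. g i w = (\<Sum>j<m. c j * e j w)" if "i \<in> insert x I" for i
      using that sp gx h0 by (metis add_0_right insertE)
    then show ?thesis using m on insert.hyps by (intro exI[of _ m] exI[of _ e]) (auto simp: insert.hyps)
  next
    case False
    define e' where "e' = e(m := (\<lambda>w. h w / sqrt N))"
    have e'm: "e' m = (\<lambda>w. h w / sqrt N)" and e'l: "\<And>j. j < m \<Longrightarrow> e' j = e j" by (auto simp: e'_def)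
    have "(\<Sum>w\<in>S. p w * (e' m w * e' m w)) = N / (sqrt N * sqrt N)"
      by (simp add: e'm N_def sum_divide_distrib)
    then have mm: "(\<Sum>w\<in>S. p w * (e' m w * e' m w)) = 1" using False N0 by simp
    have ml: "(\<Sum>w\<in>S. p w * (e' m w * e' j w)) = 0" if "j < m" for j
      using orth[OF that] that by (simp add: e'm e'l flip: sum_divide_distrib)
    have lm: "(\<Sum>w\<in>S. p w * (e' j w * e' m w)) = 0" if "j < m" for j
      using ml[OF that] by (simp add: mult.commute)
    have on': "(\<Sum>w\<in>S. p w * (e' i w * e' j w)) = (if i = j then 1 else 0)" if "i < Suc m" "j < Suc m" for i j
      using that mm ml lm on by (auto simp: less_Suc_eq e'l)
    have "\<exists>c. \<forall>w\<in>S. g i w = (\<Sum>j<Suc m. c j * e' j w)" if "i \<in> insert x I" for i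
    proof (cases "i = x")
      case True
      have "\<forall>w\<in>S. g i w = (\<Sum>j<Suc m. (c(m := sqrt N)) j * e' j w)"
        using True False N0 by (auto simp: gx e'm e'l)
      then show ?thesis by blast
    next
      case False
      then obtain b where "\<forall>w\<in>S. g i w = (\<Sum>j<m. b j * e j w)" using sp \<open>i \<in> insert x I\<close> by blast
      then have "\<forall>w\<in>S. g i w = (\<Sum>j<Suc m. (b(m := 0)) j * e' j w)" by (auto simp: e'l)
      then show ?thesis by blast
    qed
    then show ?thesis using m on' insert.hyps
      by (intro exI[of _ "Suc m"] exI[of _ e']) auto
  qed
qed

section \<open>Moments of sums over independent samples\<close>

lemma pmf_Markov_inequality:
  fixes u :: "'a \<Rightarrow> real"
  assumes "finite (set_pmf M)" "\<And>x. x \<in> set_pmf M \<Longrightarrow> 0 \<le> u x" "0 < c"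
  shows "measure_pmf.prob M {x. c \<le> u x} \<le> measure_pmf.expectation M u / c"
  using integral_Markov_inequality_measure[of M u UNIV c] assms
  by (simp add: integrable_measure_pmf_finite AE_measure_pmf_iff)

lemma finite_set_Pi_pmf:
  assumes "finite A" "\<And>x. x \<in> A \<Longrightarrow> finite (set_pmf (p x))"
  shows "finite (set_pmf (Pi_pmf A d p))"
  using assms by (simp add: set_Pi_pmf finite_PiE_dflt)

lemma expectation_Pi_pmf_component:
  fixes f :: "'b \<Rightarrow> real"
  assumes "finite A" "t \<in> A"
  shows "measure_pmf.expectation (Pi_pmf A d p) (\<lambda>ws. f (ws t)) = measure_pmf.expectation (p t) f"
proof -
  have "measure_pmf.expectation (p t) f = measure_pmf.expectation (map_pmf (\<lambda>ws. ws t) (Pi_pmf A d p)) f"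
    using assms by (simp add: Pi_pmf_component)
  then show ?thesis by simp
qed

lemma expectation_Pi_pmf_sum:
  fixes f :: "'b \<Rightarrow> real"
  assumes "finite A" "finite (set_pmf P)"
  shows "measure_pmf.expectation (Pi_pmf A d (\<lambda>_. P)) (\<lambda>ws. \<Sum>t\<in>A. f (ws t))
    = real (card A) * measure_pmf.expectation P f"
proof -
  have "measure_pmf.expectation (Pi_pmf A d (\<lambda>_. P)) (\<lambda>ws. \<Sum>t\<in>A. f (ws t))
    = (\<Sum>t\<in>A. measure_pmf.expectation (Pi_pmf A d (\<lambda>_. P)) (\<lambda>ws. f (ws t)))"
    using assms by (intro Bochner_Integration.integral_sum integrable_measure_pmf_finite finite_set_Pi_pmf) auto
  then show ?thesis using assms by (simp add: expectation_Pi_pmf_component)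
qed

text \<open>After expanding the square, the off-diagonal terms factor by independence and vanish
  because \<open>f\<close> is centred.\<close>

lemma expectation_Pi_pmf_sum_square:
  fixes f :: "'b \<Rightarrow> real"
  assumes A: "finite A" and P: "finite (set_pmf P)" and f0: "measure_pmf.expectation P f = 0"
  shows "measure_pmf.expectation (Pi_pmf A d (\<lambda>_. P)) (\<lambda>ws. (\<Sum>t\<in>A. f (ws t))\<^sup>2)
    = real (card A) * measure_pmf.expectation P (\<lambda>w. (f w)\<^sup>2)"
proof -
  let ?M = "Pi_pmf A d (\<lambda>_. P)"
  have int: "integrable ?M (h :: _ \<Rightarrow> real)" for h
    using A P by (intro integrable_measure_pmf_finite finite_set_Pi_pmf) auto
  have pair: "measure_pmf.expectation ?M (\<lambda>ws. f (ws t) * f (ws u))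
      = (if t = u then measure_pmf.expectation P (\<lambda>w. (f w)\<^sup>2) else 0)" if tu: "t \<in> A" "u \<in> A" for t u
  proof (cases "t = u")
    case True
    then show ?thesis using expectation_Pi_pmf_component[OF A tu(1), of d "\<lambda>_. P" "\<lambda>w. (f w)\<^sup>2"]
      by (simp add: power2_eq_square)
  next
    case False
    have "prob_space.indep_vars ?M (\<lambda>_. borel) (\<lambda>x ws. f (ws x)) A"
      using prob_space.indep_vars_compose2[OF measure_pmf.prob_space_axioms indep_vars_Pi_pmf[OF A, where dflt = d and p = "\<lambda>_. P"],
          where Y = "\<lambda>_. f" and N = "\<lambda>_. borel"] by simp
    from prob_space.indep_vars_subset[OF measure_pmf.prob_space_axioms this, of "{t, u}"]
    have "prob_space.indep_vars ?M (\<lambda>_. borel) (\<lambda>x ws. f (ws x)) {t, u}" using tu by simp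
    then have "measure_pmf.expectation ?M (\<lambda>ws. \<Prod>x\<in>{t,u}. f (ws x))
       = (\<Prod>x\<in>{t,u}. measure_pmf.expectation ?M (\<lambda>ws. f (ws x)))"
      by (rule prob_space.indep_vars_lebesgue_integral[OF measure_pmf.prob_space_axioms, rotated]) (simp_all add: int)
    then show ?thesis using False tu A by (simp add: expectation_Pi_pmf_component f0)
  qed
  have "measure_pmf.expectation ?M (\<lambda>ws. (\<Sum>t\<in>A. f (ws t))\<^sup>2)
     = measure_pmf.expectation ?M (\<lambda>ws. \<Sum>t\<in>A. \<Sum>u\<in>A. f (ws t) * f (ws u))"
    by (simp add: power2_eq_square sum_product)
  also have "\<dots> = (\<Sum>t\<in>A. \<Sum>u\<in>A. measure_pmf.expectation ?M (\<lambda>ws. f (ws t) * f (ws u)))"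
    by (simp add: Bochner_Integration.integral_sum int)
  also have "\<dots> = (\<Sum>t\<in>A. \<Sum>u\<in>A. if t = u then measure_pmf.expectation P (\<lambda>w. (f w)\<^sup>2) else 0)"
    by (intro sum.cong refl pair)
  also have "\<dots> = real (card A) * measure_pmf.expectation P (\<lambda>w. (f w)\<^sup>2)"
    using A by simp
  finally show ?thesis .
qed

section \<open>Chernoff bound for a single deviation\<close>

text \<open>With \<open>a = sqrt (1 + y)\<close> everything reduces to
  \<open>(a - 1) ^ 4 \<ge> 0\<close>. The correction term is a quarter of the integrand of the
  triangular discrimination.\<close>

lemma sqrt_one_plus_le:
  fixes y :: real
  assumes "-1 \<le> y"
  shows "sqrt (1 + y) \<le> 1 + y / 2 - y\<^sup>2 / (4 * (2 + y))"
proof -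
  define a where "a = sqrt (1 + y)"
  have a: "a \<ge> 0" "a * a = 1 + y" using assms by (auto simp: a_def)
  have y: "y = a * a - 1" using a by simp
  have key: "(a * a - 1)\<^sup>2 \<le> 2 * (a - 1)\<^sup>2 * (1 + a * a)"
  proof -
    have "2 * (a - 1)\<^sup>2 * (1 + a * a) - (a * a - 1)\<^sup>2 = ((a - 1)\<^sup>2)\<^sup>2"
      by (simp add: power2_eq_square algebra_simps)
    then show ?thesis using zero_le_power2[of "(a - 1)\<^sup>2"] by linarith
  qed
  have pos: "1 + a * a > 0" by (simp add: add_pos_nonneg)
  have "(a * a - 1)\<^sup>2 / (4 * (1 + a * a)) \<le> (a - 1)\<^sup>2 / 2"
    using key pos by (simp add: divide_le_eq algebra_simps)
  also have "\<dots> = 1 + (a * a - 1) / 2 - a" by (simp add: power2_eq_square field_simps)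
  finally have "a \<le> 1 + (a * a - 1) / 2 - (a * a - 1)\<^sup>2 / (4 * (1 + a * a))" by simp
  then show ?thesis unfolding a_def[symmetric] a(2) by simp
qed

text \<open>Chernoff's method with exponent \<open>1/2\<close>: as \<open>z\<close> is centred,
  \<open>sqrt_one_plus_le\<close> and independence give the product of square roots mean at most
  \<open>exp (- (n * h / 4))\<close>. Markov's inequality spends half of that exponent to reach down
  to the negative level \<open>- (n * h / 4)\<close>; this margin later pays for the passage to a
  net.\<close>

lemma loglik_ratio_Chernoff:
  fixes z :: "'a \<Rightarrow> real"
  assumes P: "finite (set_pmf P)" and z: "\<And>w. w \<in> set_pmf P \<Longrightarrow> -1 < z w"
    and z0: "measure_pmf.expectation P z = 0"
    and h: "measure_pmf.expectation P (\<lambda>w. (z w)\<^sup>2 / (2 + z w)) = h"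
  shows "measure_pmf.prob (Pi_pmf {..<n} d (\<lambda>_. P)) {ws. - (real n * h / 4) \<le> (\<Sum>t<n. ln (1 + z (ws t)))}
    \<le> exp (- (real n * h / 8))"
proof -
  let ?M = "Pi_pmf {..<n} d (\<lambda>_. P)"
  define X where "X ws = (\<Prod>t<n. sqrt (1 + z (ws t)))" for ws
  have int: "integrable P (h :: _ \<Rightarrow> real)" for h using P by (rule integrable_measure_pmf_finite)
  have inS: "ws t \<in> set_pmf P" if "ws \<in> set_pmf ?M" "t < n" for ws t
    using that by (auto simp: set_Pi_pmf PiE_dflt_def)
  have Xexp: "X ws = exp ((\<Sum>t<n. ln (1 + z (ws t))) / 2)" if "ws \<in> set_pmf ?M" for ws
  proof -
    have "sqrt (1 + z (ws t)) = exp (ln (1 + z (ws t)) / 2)" if "t < n" for t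
    proof -
      have "0 < 1 + z (ws t)" using z[OF inS[OF \<open>ws \<in> _\<close> that]] by simp
      then show ?thesis by (simp flip: ln_sqrt)
    qed
    then show ?thesis by (simp add: X_def sum_divide_distrib exp_sum)
  qed
  have one: "measure_pmf.expectation P (\<lambda>w. sqrt (1 + z w)) \<le> exp (- h / 4)"
  proof -
    have "measure_pmf.expectation P (\<lambda>w. sqrt (1 + z w))
      \<le> measure_pmf.expectation P (\<lambda>w. 1 + z w / 2 - 1 / 4 * ((z w)\<^sup>2 / (2 + z w)))"
      using sqrt_one_plus_le z by (intro integral_mono_AE int) (fastforce simp: AE_measure_pmf_iff mult.commute)
    also have "\<dots> = 1 - h / 4" using z0 h by (simp only: int Bochner_Integration.integral_diff Bochner_Integration.integral_add integral_mult_right_zero integral_divide_zero) simp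
    also have "\<dots> \<le> exp (- h / 4)" using exp_ge_add_one_self[of "- h / 4"] by simp
    finally show ?thesis .
  qed
  have EX: "measure_pmf.expectation ?M X \<le> exp (- (real n * h / 4))"
  proof -
    have "measure_pmf.expectation ?M X = (measure_pmf.expectation P (\<lambda>w. sqrt (1 + z w))) ^ n"
      unfolding X_def using z by (subst expectation_prod_Pi_pmf) (fastforce simp: int)+
    also have "\<dots> \<le> exp (- h / 4) ^ n"
      using z by (intro power_mono one integral_nonneg_AE) (fastforce simp: AE_measure_pmf_iff)
    finally show ?thesis by (simp flip: exp_of_nat_mult)
  qed
  have "measure_pmf.prob ?M {ws. - (real n * h / 4) \<le> (\<Sum>t<n. ln (1 + z (ws t)))}
      \<le> measure_pmf.prob ?M {ws. exp (- (real n * h / 8)) \<le> X ws}"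
    by (rule measure_pmf.finite_measure_mono_AE) (auto simp: AE_measure_pmf_iff Xexp mult.commute)
  also have "\<dots> \<le> measure_pmf.expectation ?M X / exp (- (real n * h / 8))"
    using P z inS by (intro pmf_Markov_inequality finite_set_Pi_pmf) (auto simp: Xexp)
  also have "\<dots> \<le> exp (- (real n * h / 4)) / exp (- (real n * h / 8))"
    using EX by (simp add: divide_right_mono)
  also have "\<dots> = exp (- (real n * h / 8))" by (simp flip: exp_diff)
  finally show ?thesis .
qed

section \<open>Nets and log-likelihood increments\<close>

text \<open>Coordinates are rounded down to a grid of side \<open>\<epsilon>\<close> and one point
  is kept per occupied cell. The points are taken from \<open>V\<close> itself, so they inherit
  every constraint that defines \<open>V\<close>.\<close>

lemma finite_grid_net:
  fixes c :: "'b \<Rightarrow> nat \<Rightarrow> real"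
  assumes side: "0 < \<epsilon>" and c: "\<And>z j. z \<in> V \<Longrightarrow> j < m \<Longrightarrow> \<bar>c z j\<bar> \<le> X * \<epsilon>"
  obtains N where "N \<subseteq> V" "finite N" "real (card N) \<le> (2 * \<bar>X\<bar> + 2) ^ m"
    "\<And>z. z \<in> V \<Longrightarrow> \<exists>z'\<in>N. \<forall>j<m. \<bar>c z j - c z' j\<bar> \<le> \<epsilon>"
proof -
  define T where "T = \<lfloor>\<bar>X\<bar>\<rfloor>"
  have T0: "0 \<le> T" by (simp add: T_def)
  define cell where "cell z = restrict (\<lambda>j. \<lfloor>c z j / \<epsilon>\<rfloor>) {..<m}" for z
  \<comment> \<open>A floor may reach \<open>-T - 1\<close> on the negative side, hence
    \<open>2 * T + 2\<close> values per coordinate.\<close>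
  have cell_in: "cell ` V \<subseteq> PiE {..<m} (\<lambda>_. {-T-1..T})"
  proof (clarsimp simp: cell_def)
    fix z j assume "z \<in> V" "j < m"
    then have "\<bar>c z j / \<epsilon>\<bar> \<le> \<bar>X\<bar>"
      using c[of z j] side by (simp add: divide_le_eq) (smt (verit) mult_right_mono)
    then have "c z j / \<epsilon> \<le> \<bar>X\<bar>" "- \<bar>X\<bar> \<le> c z j / \<epsilon>" by (simp_all only: abs_le_iff) linarith
    then show "- T - 1 \<le> \<lfloor>c z j / \<epsilon>\<rfloor> \<and> \<lfloor>c z j / \<epsilon>\<rfloor> \<le> T"
      unfolding T_def by linarith
  qed
  have fin: "finite (cell ` V)" using cell_in by (rule finite_subset) (intro finite_PiE, auto)
  have "card (cell ` V) \<le> card (PiE {..<m} (\<lambda>_. {-T-1..T}))"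
    using cell_in by (intro card_mono finite_PiE) auto
  also have "\<dots> = nat (2 * T + 2) ^ m" by (simp add: card_PiE add.commute)
  finally have "real (card (cell ` V)) \<le> real (nat (2 * T + 2) ^ m)" by (rule of_nat_mono)
  also have "\<dots> = (2 * real_of_int T + 2) ^ m" using T0 by simp
  also have "\<dots> \<le> (2 * \<bar>X\<bar> + 2) ^ m" using T0 by (intro power_mono) (auto simp: T_def)
  finally have cardc: "real (card (cell ` V)) \<le> (2 * \<bar>X\<bar> + 2) ^ m" .
  define rep where "rep = inv_into V cell"
  have rep: "rep (cell z) \<in> V" "cell (rep (cell z)) = cell z" if "z \<in> V" for z
    using that by (simp_all add: rep_def inv_into_into f_inv_into_f)
  have "\<bar>c z j - c (rep (cell z)) j\<bar> \<le> \<epsilon>" if "z \<in> V" "j < m" for z j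
  proof -
    have "cell (rep (cell z)) j = cell z j" using rep(2)[OF that(1)] by simp
    then have "\<lfloor>c (rep (cell z)) j / \<epsilon>\<rfloor> = \<lfloor>c z j / \<epsilon>\<rfloor>" using that by (simp add: cell_def)
    then have "\<bar>c z j / \<epsilon> - c (rep (cell z)) j / \<epsilon>\<bar> \<le> 1" by linarith
    then show ?thesis using side by (simp add: divide_le_eq flip: diff_divide_distrib)
  qed
  moreover have "real (card (rep ` cell ` V)) \<le> (2 * \<bar>X\<bar> + 2) ^ m"
    using card_image_le[OF fin, of rep] cardc by linarith
  ultimately show ?thesis using fin rep(1)
    by (intro that[of "rep ` cell ` V"]) auto
qed

lemma expectation_orthonormal_sum_square:
  fixes e :: "nat \<Rightarrow> 'a \<Rightarrow> real"
  assumes P: "finite (set_pmf P)"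
    and on: "\<And>i j. i < m \<Longrightarrow> j < m \<Longrightarrow> measure_pmf.expectation P (\<lambda>w. e i w * e j w) = (if i = j then 1 else 0)"
    and z: "\<And>w. w \<in> set_pmf P \<Longrightarrow> z w = (\<Sum>j<m. c j * e j w)"
  shows "measure_pmf.expectation P (\<lambda>w. (z w)\<^sup>2) = (\<Sum>j<m. (c j)\<^sup>2)"
proof -
  have int: "integrable P (h :: _ \<Rightarrow> real)" for h using P by (rule integrable_measure_pmf_finite)
  have "measure_pmf.expectation P (\<lambda>w. (z w)\<^sup>2)
      = measure_pmf.expectation P (\<lambda>w. \<Sum>i<m. \<Sum>j<m. c i * c j * (e i w * e j w))"
    by (rule integral_cong_AE)
      (auto simp: AE_measure_pmf_iff z power2_eq_square sum_product mult.assoc mult.left_commute intro!: sum.cong)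
  also have "\<dots> = (\<Sum>i<m. \<Sum>j<m. c i * c j * measure_pmf.expectation P (\<lambda>w. e i w * e j w))"
    by (simp only: Bochner_Integration.integral_sum int integral_mult_right_zero)
  also have "\<dots> = (\<Sum>i<m. \<Sum>j<m. if i = j then c i * c j else 0)"
    by (intro sum.cong refl) (simp add: on)
  also have "\<dots> = (\<Sum>j<m. (c j)\<^sup>2)" by (simp add: power2_eq_square)
  finally show ?thesis .
qed

lemma abs_sum_mult_le:
  fixes a b :: "'a \<Rightarrow> real"
  assumes "(\<Sum>i\<in>I. (a i)\<^sup>2) \<le> \<alpha>\<^sup>2" "(\<Sum>i\<in>I. (b i)\<^sup>2) \<le> \<beta>\<^sup>2" "0 \<le> \<alpha>" "0 \<le> \<beta>"
  shows "\<bar>\<Sum>i\<in>I. a i * b i\<bar> \<le> \<alpha> * \<beta>"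
proof -
  have "(\<Sum>i\<in>I. a i * b i)\<^sup>2 \<le> (\<Sum>i\<in>I. (a i)\<^sup>2) * (\<Sum>i\<in>I. (b i)\<^sup>2)"
    by (rule Cauchy_Schwarz_ineq_sum)
  also have "\<dots> \<le> \<alpha>\<^sup>2 * \<beta>\<^sup>2" using assms by (intro mult_mono sum_nonneg) auto
  also have "\<dots> = (\<alpha> * \<beta>)\<^sup>2" by (simp add: power_mult_distrib)
  finally show ?thesis using assms abs_le_square_iff[of "\<Sum>i\<in>I. a i * b i" "\<alpha> * \<beta>"] by simp
qed

text \<open>Splitting \<open>u / (1 + z') = u - u z' / (1 + z')\<close> leaves a term linear in \<open>u\<close> and a
  remainder of second order, so no exponential deviation bound is needed for the increments.\<close>

lemma sum_ln_perturbation: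
  fixes e :: "nat \<Rightarrow> 'a \<Rightarrow> real"
  assumes z: "\<And>t. t < n \<Longrightarrow> z (ws t) = (\<Sum>j<m. c j * e j (ws t))"
    and z': "\<And>t. t < n \<Longrightarrow> z' (ws t) = (\<Sum>j<m. c' j * e j (ws t))"
    and low: "\<And>t. t < n \<Longrightarrow> -1/2 \<le> z (ws t)" "\<And>t. t < n \<Longrightarrow> -1/2 \<le> z' (ws t)"
    and mean: "(\<Sum>j<m. (c j - c' j) * \<mu> j) = 0"
    and lin: "(\<Sum>j<m. ((\<Sum>t<n. e j (ws t) - \<mu> j))\<^sup>2) \<le> \<Lambda>\<^sup>2"
    and quad: "(\<Sum>t<n. \<Sum>j<m. (e j (ws t))\<^sup>2) \<le> \<Gamma>"
    and diff: "(\<Sum>j<m. (c j - c' j)\<^sup>2) \<le> \<eta>\<^sup>2" and size: "(\<Sum>j<m. (c' j)\<^sup>2) \<le> \<beta>\<^sup>2"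
    and nonneg: "0 \<le> \<Lambda>" "0 \<le> \<eta>" "0 \<le> \<beta>"
  shows "(\<Sum>t<n. ln (1 + z (ws t))) \<le> (\<Sum>t<n. ln (1 + z' (ws t))) + \<eta> * \<Lambda> + 2 * \<eta> * \<beta> * \<Gamma>"
proof -
  define u where "u t = z (ws t) - z' (ws t)" for t
  define E where "E t = (\<Sum>j<m. (e j (ws t))\<^sup>2)" for t
  have E0: "0 \<le> E t" for t by (simp add: E_def sum_nonneg)
  have u: "u t = (\<Sum>j<m. (c j - c' j) * e j (ws t))" if "t < n" for t
    using that by (simp add: u_def z z' sum_subtractf algebra_simps)
  \<comment> \<open>Cauchy-Schwarz bounds both \<open>u t\<close> and \<open>z' (ws t)\<close> by
    multiples of \<open>sqrt (E t)\<close>, so their product is controlled by \<open>E t\<close>.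
    The factor \<open>2\<close> comes from \<open>1 + z' \<ge> 1/2\<close> in the
    denominator.\<close>
  have step: "ln (1 + z (ws t)) \<le> ln (1 + z' (ws t)) + u t + 2 * \<eta> * \<beta> * E t" if t: "t < n" for t
  proof -
    have E2: "E t = (sqrt (E t))\<^sup>2" using E0[of t] by simp
    have ub: "\<bar>u t\<bar> \<le> \<eta> * sqrt (E t)"
      unfolding u[OF t] by (rule abs_sum_mult_le[OF diff _ nonneg(2)]) (use E2 E0[of t] in \<open>auto simp: E_def\<close>)
    have zb: "\<bar>z' (ws t)\<bar> \<le> \<beta> * sqrt (E t)"
      unfolding z'[OF t] by (rule abs_sum_mult_le[OF size _ nonneg(3)]) (use E2 E0[of t] in \<open>auto simp: E_def\<close>)
    have "\<bar>u t\<bar> * \<bar>z' (ws t)\<bar> \<le> (\<eta> * sqrt (E t)) * (\<beta> * sqrt (E t))"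
      by (rule mult_mono[OF ub zb]) (use nonneg E0[of t] in auto)
    also have "\<dots> = \<eta> * \<beta> * E t" using E0[of t] by (simp add: algebra_simps flip: real_sqrt_mult)
    finally have uz: "\<bar>u t * z' (ws t)\<bar> \<le> \<eta> * \<beta> * E t" by (simp add: abs_mult)
    have pos: "1/2 \<le> 1 + z' (ws t)" using low(2)[OF t] by simp
    have "ln (1 + z (ws t)) - ln (1 + z' (ws t)) \<le> u t / (1 + z' (ws t))"
      using ln_diff_le[of "1 + z (ws t)" "1 + z' (ws t)"] low(1)[OF t] pos by (simp add: u_def)
    also have "\<dots> = u t + (- (u t * z' (ws t))) / (1 + z' (ws t))"
      using pos by (simp add: field_simps)
    also have "(- (u t * z' (ws t))) / (1 + z' (ws t)) \<le> (\<eta> * \<beta> * E t) / (1 + z' (ws t))"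
      using uz pos by (intro divide_right_mono) auto
    also have "\<dots> \<le> (\<eta> * \<beta> * E t) / (1/2)"
      using pos nonneg E0[of t] by (intro divide_left_mono) auto
    finally show ?thesis by simp
  qed
  \<comment> \<open>By \<open>mean\<close> the subtraction of \<open>\<mu>\<close> costs nothing,
    and it replaces raw empirical sums by their fluctuations.\<close>
  have "(\<Sum>t<n. u t) = (\<Sum>j<m. (c j - c' j) * (\<Sum>t<n. e j (ws t) - \<mu> j))"
  proof -
    have "(\<Sum>t<n. u t) = (\<Sum>t<n. (\<Sum>j<m. (c j - c' j) * e j (ws t)) - (\<Sum>j<m. (c j - c' j) * \<mu> j))"
      unfolding mean by (intro sum.cong) (auto simp: u)
    also have "\<dots> = (\<Sum>t<n. \<Sum>j<m. (c j - c' j) * (e j (ws t) - \<mu> j))"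
      by (simp add: sum_subtractf[symmetric] right_diff_distrib)
    also have "\<dots> = (\<Sum>j<m. (c j - c' j) * (\<Sum>t<n. e j (ws t) - \<mu> j))"
      by (subst sum.swap) (simp add: sum_distrib_left)
    finally show ?thesis .
  qed
  also have "\<dots> \<le> \<eta> * \<Lambda>" using abs_sum_mult_le[OF diff lin nonneg(2,1)] by linarith
  finally have usum: "(\<Sum>t<n. u t) \<le> \<eta> * \<Lambda>" .
  have "(\<Sum>t<n. ln (1 + z (ws t))) \<le> (\<Sum>t<n. ln (1 + z' (ws t)) + u t + 2 * \<eta> * \<beta> * E t)"
    by (intro sum_mono step) simp
  also have "\<dots> = (\<Sum>t<n. ln (1 + z' (ws t))) + (\<Sum>t<n. u t) + 2 * \<eta> * \<beta> * (\<Sum>t<n. E t)"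
    by (simp add: sum.distrib sum_distrib_left)
  also have "\<dots> \<le> (\<Sum>t<n. ln (1 + z' (ws t))) + \<eta> * \<Lambda> + 2 * \<eta> * \<beta> * \<Gamma>"
    using usum quad nonneg by (intro add_mono mult_left_mono) (auto simp: E_def)
  finally show ?thesis .
qed

text \<open>Each centred sum has second moment \<open>n\<close> times a variance, and that variance
  is at most the second moment \<open>1\<close>; Markov's inequality does the rest.\<close>

lemma orthonormal_empirical_linear_prob:
  fixes e :: "nat \<Rightarrow> 'a \<Rightarrow> real"
  assumes P: "finite (set_pmf P)"
    and on: "\<And>j. j < m \<Longrightarrow> measure_pmf.expectation P (\<lambda>w. (e j w)\<^sup>2) = 1" and B: "0 < B"
  shows "measure_pmf.prob (Pi_pmf {..<n} d (\<lambda>_. P))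
     {ws. B \<le> (\<Sum>j<m. (\<Sum>t<n. e j (ws t) - measure_pmf.expectation P (e j))\<^sup>2)} \<le> real n * real m / B"
proof -
  let ?M = "Pi_pmf {..<n} d (\<lambda>_. P)" and ?\<mu> = "\<lambda>j. measure_pmf.expectation P (e j)"
  have int: "integrable P (h :: _ \<Rightarrow> real)" for h using P by (rule integrable_measure_pmf_finite)
  have fM: "finite (set_pmf ?M)" using P by (intro finite_set_Pi_pmf) auto
  have one: "measure_pmf.expectation ?M (\<lambda>ws. (\<Sum>t<n. e j (ws t) - ?\<mu> j)\<^sup>2) \<le> real n" if j: "j < m" for j
  proof -
    have "measure_pmf.expectation P (\<lambda>w. e j w - ?\<mu> j) = 0"
      by (simp add: int)
    then have "measure_pmf.expectation ?M (\<lambda>ws. (\<Sum>t<n. e j (ws t) - ?\<mu> j)\<^sup>2)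
        = real n * measure_pmf.expectation P (\<lambda>w. (e j w - ?\<mu> j)\<^sup>2)"
      using expectation_Pi_pmf_sum_square[of "{..<n}" P "\<lambda>w. e j w - ?\<mu> j" d] P by simp
    also have "measure_pmf.expectation P (\<lambda>w. (e j w - ?\<mu> j)\<^sup>2) = 1 - (?\<mu> j)\<^sup>2"
      using measure_pmf.variance_eq[of P "e j"] on[OF j] by (simp add: int)
    also have "real n * (1 - (?\<mu> j)\<^sup>2) \<le> real n * 1" by (intro mult_left_mono) auto
    finally show ?thesis by simp
  qed
  have "measure_pmf.expectation ?M (\<lambda>ws. \<Sum>j<m. (\<Sum>t<n. e j (ws t) - ?\<mu> j)\<^sup>2)
      = (\<Sum>j<m. measure_pmf.expectation ?M (\<lambda>ws. (\<Sum>t<n. e j (ws t) - ?\<mu> j)\<^sup>2))"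
    by (intro Bochner_Integration.integral_sum integrable_measure_pmf_finite fM)
  also have "\<dots> \<le> (\<Sum>j<m. real n)" by (intro sum_mono one) simp
  finally have "measure_pmf.expectation ?M (\<lambda>ws. \<Sum>j<m. (\<Sum>t<n. e j (ws t) - ?\<mu> j)\<^sup>2) \<le> real n * real m"
    by (simp add: mult.commute)
  then show ?thesis
    using pmf_Markov_inequality[OF fM, of "\<lambda>ws. \<Sum>j<m. (\<Sum>t<n. e j (ws t) - ?\<mu> j)\<^sup>2" B] B
    by (smt (verit) divide_right_mono sum_nonneg zero_le_power2)
qed

lemma orthonormal_empirical_square_prob:
  fixes e :: "nat \<Rightarrow> 'a \<Rightarrow> real"
  assumes P: "finite (set_pmf P)"
    and on: "\<And>j. j < m \<Longrightarrow> measure_pmf.expectation P (\<lambda>w. (e j w)\<^sup>2) = 1" and B: "0 < B"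
  shows "measure_pmf.prob (Pi_pmf {..<n} d (\<lambda>_. P)) {ws. B \<le> (\<Sum>t<n. \<Sum>j<m. (e j (ws t))\<^sup>2)} \<le> real n * real m / B"
proof -
  let ?M = "Pi_pmf {..<n} d (\<lambda>_. P)"
  have int: "integrable P (h :: _ \<Rightarrow> real)" for h using P by (rule integrable_measure_pmf_finite)
  have "measure_pmf.expectation P (\<lambda>w. \<Sum>j<m. (e j w)\<^sup>2) = (\<Sum>j<m. measure_pmf.expectation P (\<lambda>w. (e j w)\<^sup>2))"
    by (intro Bochner_Integration.integral_sum int)
  also have "\<dots> = real m" by (simp add: on)
  finally have "measure_pmf.expectation ?M (\<lambda>ws. \<Sum>t<n. \<Sum>j<m. (e j (ws t))\<^sup>2) = real n * real m"
    using expectation_Pi_pmf_sum[of "{..<n}" P d "\<lambda>w. \<Sum>j<m. (e j w)\<^sup>2"] P by simp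
  moreover have "finite (set_pmf ?M)" using P by (intro finite_set_Pi_pmf) auto
  ultimately show ?thesis
    using pmf_Markov_inequality[of ?M "\<lambda>ws. \<Sum>t<n. \<Sum>j<m. (e j (ws t))\<^sup>2" B] B by (simp add: sum_nonneg)
qed

section \<open>Union bound over a shell\<close>

text \<open>The two summands \<open>1 / L\<close> come from Markov's inequality for the empirical
  moments, the last term from the Chernoff bound at each net point. Outside these events a net point
  has log-likelihood ratio below \<open>- (n * \<rho>^2 / 4)\<close>, and moving from it to any
  point of \<open>V\<close> gains at most \<open>3/32\<close> of
  \<open>n * \<rho>^2\<close>.\<close>

lemma localized_loglik_ratio_prob:
  fixes e :: "nat \<Rightarrow> 'a \<Rightarrow> real" and V :: "('a \<Rightarrow> real) set"
  assumes P: "finite (set_pmf P)"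
    and on: "\<And>i j. i < m \<Longrightarrow> j < m \<Longrightarrow> measure_pmf.expectation P (\<lambda>w. e i w * e j w) = (if i = j then 1 else 0)"
    and span: "\<And>z. z \<in> V \<Longrightarrow> \<exists>c. \<forall>w\<in>set_pmf P. z w = (\<Sum>j<m. c j * e j w)"
    and low: "\<And>z w. z \<in> V \<Longrightarrow> w \<in> set_pmf P \<Longrightarrow> -1/2 \<le> z w"
    and mean: "\<And>z. z \<in> V \<Longrightarrow> measure_pmf.expectation P z = 0"
    and H: "\<And>z. z \<in> V \<Longrightarrow> measure_pmf.expectation P (\<lambda>w. (z w)\<^sup>2 / (2 + z w)) = \<rho>\<^sup>2"
    and chi: "\<And>z. z \<in> V \<Longrightarrow> measure_pmf.expectation P (\<lambda>w. (z w)\<^sup>2) \<le> (Q * \<rho>)\<^sup>2"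
    and s: "real m \<le> s" "1 \<le> s" and L: "1 \<le> L" and Q: "1 \<le> Q" and \<rho>: "0 < \<rho>"
    and n: "s * L \<le> real n * \<rho>\<^sup>2"
  shows "measure_pmf.prob (Pi_pmf {..<n} d (\<lambda>_. P)) {ws. \<exists>z\<in>V. 0 \<le> (\<Sum>t<n. ln (1 + z (ws t)))}
    \<le> 2 / L + (64 * s\<^sup>2 * L * Q\<^sup>2 + 2) ^ m * exp (- (real n * \<rho>\<^sup>2 / 8))"
proof -
  let ?M = "Pi_pmf {..<n} d (\<lambda>_. P)"
  have int: "integrable P (h :: _ \<Rightarrow> real)" for h using P by (rule integrable_measure_pmf_finite)
  define \<mu> where "\<mu> j = measure_pmf.expectation P (e j)" for j
  have sL: "0 < s * L" using s L by simp
  have n0: "0 < real n" using n sL by (cases n) auto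
  define c where "c z = (SOME c. \<forall>w\<in>set_pmf P. z w = (\<Sum>j<m. c j * e j w))" for z
  have c: "z w = (\<Sum>j<m. c z j * e j w)" if "z \<in> V" "w \<in> set_pmf P" for z w
    using someI_ex[OF span[OF that(1)]] that(2) unfolding c_def by blast
  have cnorm: "(\<Sum>j<m. (c z j)\<^sup>2) \<le> (Q * \<rho>)\<^sup>2" if "z \<in> V" for z
    using expectation_orthonormal_sum_square[OF P on c[OF that]] chi[OF that] by simp
  have cmean: "(\<Sum>j<m. c z j * \<mu> j) = 0" if "z \<in> V" for z
  proof -
    have "measure_pmf.expectation P z = measure_pmf.expectation P (\<lambda>w. \<Sum>j<m. c z j * e j w)"
      by (rule integral_cong_AE) (auto simp: AE_measure_pmf_iff c that)
    also have "\<dots> = (\<Sum>j<m. c z j * \<mu> j)"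
      by (simp only: Bochner_Integration.integral_sum int integral_mult_right_zero \<mu>_def)
    finally show ?thesis using mean[OF that] by simp
  qed
  \<comment> \<open>\<open>\<eta>\<close> is the \<open>L2(P)\<close> resolution of the net. With
    \<open>B = n * s * L\<close> below it makes the quadratic increment exactly
    \<open>n * \<rho>^2 / 16\<close> and the linear one at most \<open>n * \<rho>^2 / 32\<close>.
    The grid side \<open>\<epsilon>\<close> is smaller by \<open>s\<close>, which covers the passage
    from coordinates to the norm in dimension \<open>m \<le> s\<close>.\<close>
  define \<eta> where "\<eta> = \<rho> / (32 * s * L * Q)"
  define \<epsilon> where "\<epsilon> = \<eta> / s"
  have den: "1 \<le> s * L * Q" using mult_mono[OF mult_mono[OF s(2) L] Q] s L Q by simp
  have \<eta>0: "0 < \<eta>" using \<rho> s L Q by (simp add: \<eta>_def)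
  have \<epsilon>0: "0 < \<epsilon>" using \<eta>0 s by (simp add: \<epsilon>_def)
  \<comment> \<open>The ratio of the radius \<open>Q * \<rho>\<close> to the side
    \<open>\<epsilon>\<close>. Here \<open>\<rho>\<close> cancels, which is why the size of the net
    does not depend on \<open>n\<close>.\<close>
  define X where "X = 32 * s\<^sup>2 * L * Q\<^sup>2"
  have X\<epsilon>: "X * \<epsilon> = Q * \<rho>"
    using s L Q by (simp add: X_def \<epsilon>_def \<eta>_def power2_eq_square field_simps)
  have cb: "\<bar>c z j\<bar> \<le> X * \<epsilon>" if "z \<in> V" "j < m" for z j
  proof -
    have "(c z j)\<^sup>2 \<le> (\<Sum>j<m. (c z j)\<^sup>2)" using that by (intro member_le_sum) auto
    then have "(c z j)\<^sup>2 \<le> (Q * \<rho>)\<^sup>2" using cnorm[OF that(1)] by linarith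
    then show ?thesis using Q \<rho> X\<epsilon> abs_le_square_iff[of "c z j" "Q * \<rho>"] by simp
  qed
  obtain N where NV: "N \<subseteq> V" and Nf: "finite N" and Nc: "real (card N) \<le> (2 * \<bar>X\<bar> + 2) ^ m"
    and net: "\<And>z. z \<in> V \<Longrightarrow> \<exists>z'\<in>N. \<forall>j<m. \<bar>c z j - c z' j\<bar> \<le> \<epsilon>"
    by (rule finite_grid_net[of \<epsilon> V m c X, OF \<epsilon>0 cb], assumption, assumption, rule that)
  define B where "B = real n * s * L"
  have B0: "0 < B" using n0 sL by (simp add: B_def mult.assoc)
  have nmB: "real n * real m / B \<le> 1 / L"
    using n0 s L by (simp add: B_def field_simps)
  define E1 where "E1 = {ws. B \<le> (\<Sum>j<m. (\<Sum>t<n. e j (ws t) - \<mu> j)\<^sup>2)}"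
  define E2 where "E2 = {ws. B \<le> (\<Sum>t<n. \<Sum>j<m. (e j (ws t))\<^sup>2)}"
  define E3 where "E3 z = {ws. - (real n * \<rho>\<^sup>2 / 4) \<le> (\<Sum>t<n. ln (1 + z (ws t)))}" for z :: "'a \<Rightarrow> real"
  have on1: "measure_pmf.expectation P (\<lambda>w. (e j w)\<^sup>2) = 1" if "j < m" for j
    using on[OF that that] by (simp add: power2_eq_square)
  have p1: "measure_pmf.prob ?M E1 \<le> 1 / L"
    using orthonormal_empirical_linear_prob[where e = e and m = m and n = n and d = d, OF P on1 B0] nmB unfolding E1_def \<mu>_def by simp
  have p2: "measure_pmf.prob ?M E2 \<le> 1 / L"
    using orthonormal_empirical_square_prob[where e = e and m = m and n = n and d = d, OF P on1 B0] nmB unfolding E2_def by simp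
  have p3: "measure_pmf.prob ?M (\<Union>z\<in>N. E3 z) \<le> (2 * X + 2) ^ m * exp (- (real n * \<rho>\<^sup>2 / 8))"
  proof -
    have "measure_pmf.prob ?M (\<Union>z\<in>N. E3 z) \<le> (\<Sum>z\<in>N. measure_pmf.prob ?M (E3 z))"
      by (intro measure_pmf.finite_measure_subadditive_finite Nf) auto
    also have "\<dots> \<le> (\<Sum>z\<in>N. exp (- (real n * \<rho>\<^sup>2 / 8)))"
    proof (intro sum_mono)
      fix z assume "z \<in> N"
      then have zV: "z \<in> V" using NV by auto
      have "-1 < z w" if "w \<in> set_pmf P" for w using low[OF zV that] by simp
      then show "measure_pmf.prob ?M (E3 z) \<le> exp (- (real n * \<rho>\<^sup>2 / 8))"
        unfolding E3_def by (intro loglik_ratio_Chernoff P mean H zV)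
    qed
    also have "\<dots> = real (card N) * exp (- (real n * \<rho>\<^sup>2 / 8))" by simp
    also have "\<dots> \<le> (2 * X + 2) ^ m * exp (- (real n * \<rho>\<^sup>2 / 8))"
      using Nc L by (intro mult_right_mono) (auto simp: X_def)
    finally show ?thesis .
  qed
  have neg: "\<not> 0 \<le> (\<Sum>t<n. ln (1 + z (ws t)))"
    if ws: "ws \<in> set_pmf ?M" "ws \<notin> E1" "ws \<notin> E2" "ws \<notin> (\<Union>z\<in>N. E3 z)" and zV: "z \<in> V" for ws z
  proof -
    have inS: "ws t \<in> set_pmf P" if "t < n" for t
      using ws(1) that by (auto simp: set_Pi_pmf PiE_dflt_def)
    obtain z' where z'N: "z' \<in> N" and z': "\<And>j. j < m \<Longrightarrow> \<bar>c z j - c z' j\<bar> \<le> \<epsilon>"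
      using net[OF zV] by blast
    have z'V: "z' \<in> V" using z'N NV by auto
    have "(\<Sum>j<m. (c z j - c z' j)\<^sup>2) \<le> (\<Sum>j<m. \<epsilon>\<^sup>2)"
      using z' \<epsilon>0 by (intro sum_mono) (auto simp: abs_le_square_iff[symmetric])
    also have "\<dots> = real m * \<epsilon>\<^sup>2" by simp
    also have "\<dots> \<le> s\<^sup>2 * \<epsilon>\<^sup>2"
      using s self_le_power[of s 2] by (intro mult_right_mono) auto
    also have "\<dots> = \<eta>\<^sup>2" using s by (simp add: \<epsilon>_def power_divide)
    finally have diff: "(\<Sum>j<m. (c z j - c z' j)\<^sup>2) \<le> \<eta>\<^sup>2" .
    have "(\<Sum>t<n. ln (1 + z (ws t))) \<le> (\<Sum>t<n. ln (1 + z' (ws t))) + \<eta> * sqrt B + 2 * \<eta> * (Q * \<rho>) * B"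
    proof (rule sum_ln_perturbation[where c = "c z" and c' = "c z'" and \<mu> = \<mu> and e = e and m = m])
      show "(\<Sum>j<m. (c z j - c z' j) * \<mu> j) = 0"
        using cmean[OF zV] cmean[OF z'V] by (simp add: left_diff_distrib sum_subtractf)
      show "(\<Sum>j<m. (\<Sum>t<n. e j (ws t) - \<mu> j)\<^sup>2) \<le> (sqrt B)\<^sup>2" using ws(2) B0 by (simp add: E1_def)
      show "(\<Sum>t<n. \<Sum>j<m. (e j (ws t))\<^sup>2) \<le> B" using ws(3) by (simp add: E2_def)
    qed (use inS c low zV z'V diff cnorm B0 \<eta>0 Q \<rho> in auto)
    also have "2 * \<eta> * (Q * \<rho>) * B = real n * \<rho>\<^sup>2 / 16"
      using s L Q by (simp add: \<eta>_def B_def power2_eq_square field_simps)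
    also have "\<eta> * sqrt B \<le> real n * \<rho>\<^sup>2 / 32"
    proof -
      have "B = real n * (s * L)" by (simp add: B_def)
      also have "\<dots> \<le> real n * (real n * \<rho>\<^sup>2)" using n by (intro mult_left_mono) auto
      also have "\<dots> = (real n * \<rho>)\<^sup>2" by (simp add: power2_eq_square)
      finally have "sqrt B \<le> real n * \<rho>" using \<rho> by (intro real_le_lsqrt) auto
      moreover have "\<eta> \<le> \<rho> / 32" unfolding \<eta>_def using den \<rho> by (intro divide_left_mono) auto
      ultimately have "\<eta> * sqrt B \<le> (\<rho> / 32) * (real n * \<rho>)" using \<eta>0 \<rho> B0 by (intro mult_mono) auto
      then show ?thesis by (simp add: power2_eq_square mult_ac)
    qed
    also have "(\<Sum>t<n. ln (1 + z' (ws t))) < - (real n * \<rho>\<^sup>2 / 4)" using ws(4) z'N by (auto simp: E3_def)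
    finally have "(\<Sum>t<n. ln (1 + z (ws t))) < - (real n * \<rho>\<^sup>2 / 4) + real n * \<rho>\<^sup>2 / 32 + real n * \<rho>\<^sup>2 / 16" by simp
    moreover have "0 \<le> real n * \<rho>\<^sup>2" by simp
    ultimately show ?thesis by linarith
  qed
  have "measure_pmf.prob ?M {ws. \<exists>z\<in>V. 0 \<le> (\<Sum>t<n. ln (1 + z (ws t)))}
      \<le> measure_pmf.prob ?M ((E1 \<union> E2) \<union> (\<Union>z\<in>N. E3 z))"
    using neg by (intro measure_pmf.finite_measure_mono_AE) (auto simp: AE_measure_pmf_iff)
  also have "\<dots> \<le> measure_pmf.prob ?M (E1 \<union> E2) + measure_pmf.prob ?M (\<Union>z\<in>N. E3 z)"
    by (intro measure_Un_le) auto
  also have "measure_pmf.prob ?M (E1 \<union> E2) \<le> measure_pmf.prob ?M E1 + measure_pmf.prob ?M E2"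
    by (intro measure_Un_le) auto
  finally show ?thesis using p1 p2 p3 by (simp add: X_def mult.assoc)
qed

text \<open>Concavity of \<open>ln\<close> between \<open>1\<close> and \<open>a\<close>: the
  tangent bounds at \<open>b\<close> are weighted so that their right-hand sides cancel.\<close>

lemma ln_convex_combination_ge:
  fixes a :: real
  assumes "0 < a" "0 \<le> l" "l \<le> 1"
  shows "l * ln a \<le> ln (1 - l + l * a)"
proof -
  define b where "b = 1 - l + l * a"
  have b: "0 < b"
  proof (cases "l = 0")
    case False
    then have "0 < l * a" using assms by simp
    then show ?thesis using assms by (simp add: b_def)
  qed (simp add: b_def)
  have "(1 - l) * (ln 1 - ln b) \<le> (1 - l) * ((1 - b) / b)"
    using assms b by (intro mult_left_mono ln_diff_le) auto
  moreover have "l * (ln a - ln b) \<le> l * ((a - b) / b)"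
    using assms b by (intro mult_left_mono ln_diff_le) auto
  moreover have "(1 - l) * ((1 - b) / b) + l * ((a - b) / b) = ((1 - l) * (1 - b) + l * (a - b)) / b"
    by (simp add: add_divide_distrib)
  moreover have "(1 - l) * (1 - b) + l * (a - b) = 0" by (simp add: b_def algebra_simps)
  ultimately show ?thesis by (simp add: b_def[symmetric] algebra_simps)
qed

section \<open>The topic model and its norms\<close>

locale topic_model =
  fixes k D :: nat and A :: "nat \<Rightarrow> nat \<Rightarrow> real" and xs :: "nat \<Rightarrow> real"
    and r :: nat and \<tau> \<kappa> :: real
  assumes A_nonneg: "w < D \<Longrightarrow> i < k \<Longrightarrow> 0 \<le> A w i"
    and A_sum: "i < k \<Longrightarrow> (\<Sum>w<D. A w i) = 1"
    and xs_outside: "k \<le> i \<Longrightarrow> xs i = 0"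
    and xs_sum: "(\<Sum>i<k. xs i) = 1"
    and \<tau>_pos: "0 < \<tau>"
    and supp_card: "card (supp_k k xs) \<le> r"
    and xs_ge: "i \<in> supp_k k xs \<Longrightarrow> \<tau> / real r \<le> xs i"
    and \<kappa>_pos: "0 < \<kappa>"
    and sparse: "card {i \<in> {..<k}. v i \<noteq> 0} \<le> r \<Longrightarrow> (\<Sum>i<k. \<bar>v i\<bar>) / \<kappa> \<le> l1_Av k D A v"
begin

abbreviation "R \<equiv> supp_k k xs"
abbreviation "P \<equiv> word_pmf k D A xs"
abbreviation "dot \<equiv> rowdot A R"

definition z :: "(nat \<Rightarrow> real) \<Rightarrow> nat \<Rightarrow> real" where
  "z v w = dot w v / dot w xs"

text \<open>The triangular discrimination between the word distributions of \<open>xs + v\<close> and \<open>xs\<close>.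
  Unlike the \<open>\<chi>\<^sup>2\<close>-divergence it is comparable to the squared Hellinger distance.\<close>

definition H :: "(nat \<Rightarrow> real) \<Rightarrow> real" where
  "H v = measure_pmf.expectation P (\<lambda>w. (z v w)\<^sup>2 / (2 + z v w))"

lemma R_subset: "R \<subseteq> {..<k}" and finite_R: "finite R"
  by (auto simp: supp_k_def)

lemma sum_R: "(\<Sum>i<k. f i * xs i) = (\<Sum>i\<in>R. f i * xs i)"
  by (rule sum.mono_neutral_right) (auto simp: supp_k_def)

lemma xs_R_sum: "(\<Sum>i\<in>R. xs i) = 1"
  using sum_R[of "\<lambda>_. 1"] xs_sum by simp

lemma R_nonempty: "R \<noteq> {}"
  using xs_R_sum by auto

lemma card_R_pos: "0 < card R"
  using R_nonempty finite_R by (simp add: card_gt_0_iff)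

lemma card_R_le: "card R \<le> k"
  using card_mono[OF _ R_subset] by simp

lemma r_pos: "0 < r"
  using card_R_pos supp_card by linarith

lemma xs_pos: "i \<in> R \<Longrightarrow> 0 < xs i"
  using xs_ge[of i] \<tau>_pos r_pos by (smt (verit) divide_pos_pos of_nat_0_less_iff)

lemma A_R_nonneg: "w < D \<Longrightarrow> i \<in> R \<Longrightarrow> 0 \<le> A w i"
  using A_nonneg R_subset by auto

lemma dot_xs_nonneg: "w < D \<Longrightarrow> 0 \<le> dot w xs"
  unfolding rowdot_def using A_R_nonneg xs_pos by (intro sum_nonneg mult_nonneg_nonneg) (auto simp: less_imp_le)

lemma sum_dot: "(\<Sum>w<D. dot w v) = (\<Sum>i\<in>R. v i)"
proof -
  have "(\<Sum>w<D. dot w v) = (\<Sum>i\<in>R. (\<Sum>w<D. A w i) * v i)"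
    unfolding rowdot_def by (subst sum.swap) (simp add: sum_distrib_right)
  also have "\<dots> = (\<Sum>i\<in>R. v i)" using A_sum R_subset by (intro sum.cong) auto
  finally show ?thesis .
qed

lemma pmf_word: "pmf P w = (if w < D then dot w xs else 0)"
proof -
  let ?f = "\<lambda>w. if w < D then (\<Sum>i<k. A w i * xs i) else 0"
  have dot: "(\<Sum>i<k. A w i * xs i) = dot w xs" for w
    unfolding rowdot_def by (rule sum_R)
  have nn: "0 \<le> ?f w" for w using dot_xs_nonneg[of w] by (simp add: dot)
  have "(\<integral>\<^sup>+ w. ennreal (?f w) \<partial>count_space UNIV) = (\<Sum>w<D. ennreal (?f w))"
    by (subst nn_integral_count_space'[where A = "{..<D}"]) auto
  also have "\<dots> = ennreal (\<Sum>w<D. dot w xs)"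
    using dot_xs_nonneg by (subst sum_ennreal[symmetric]) (auto simp: dot)
  also have "\<dots> = 1" by (simp add: sum_dot xs_R_sum)
  finally have one: "(\<integral>\<^sup>+ w. ennreal (?f w) \<partial>count_space UNIV) = 1" .
  show ?thesis unfolding word_pmf_def using pmf_embed_pmf[of ?f w, OF nn one] by (simp add: dot)
qed

lemma set_word: "set_pmf P = {w. w < D \<and> 0 < dot w xs}"
  using dot_xs_nonneg by (force simp: set_pmf_eq pmf_word)

lemma finite_set_word: "finite (set_pmf P)"
  by (rule finite_subset[of _ "{..<D}"]) (auto simp: set_word)

text \<open>A sum of nonnegative terms with strictly positive weights \<open>xs i\<close> vanishes
  only if row \<open>w\<close> vanishes on \<open>R\<close>. So words that cannot occur carry no
  mass for any \<open>v\<close>, and the value \<open>0\<close> that division by zero gives to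
  \<open>z\<close> there is harmless.\<close>

lemma dot_eq_0: "dot w v = 0" if "w < D" "w \<notin> set_pmf P"
proof -
  have "dot w xs = 0" using that dot_xs_nonneg[of w] by (auto simp: set_word)
  then have "A w i * xs i = 0" if "i \<in> R" for i
    unfolding rowdot_def using \<open>w < D\<close> that finite_R A_R_nonneg xs_pos
    by (subst (asm) sum_nonneg_eq_0_iff) (auto simp: less_imp_le)
  then have "A w i = 0" if "i \<in> R" for i using xs_pos[OF that] that by fastforce
  then show ?thesis by (simp add: rowdot_def)
qed

lemma dot_eq: "w < D \<Longrightarrow> dot w v = dot w xs * z v w"
  using dot_eq_0[of w v] by (cases "w \<in> set_pmf P") (auto simp: z_def set_word)

lemma expectation_word:
  "measure_pmf.expectation P f = (\<Sum>w<D. dot w xs * f w)" for f :: "nat \<Rightarrow> real"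
proof -
  have "measure_pmf.expectation P f = (\<Sum>w<D. pmf P w *\<^sub>R f w)"
    by (rule integral_measure_pmf) (auto simp: set_word)
  then show ?thesis by (simp add: pmf_word)
qed

lemma expectation_z: "measure_pmf.expectation P (z v) = (\<Sum>i\<in>R. v i)"
  unfolding expectation_word by (simp add: sum_dot flip: dot_eq)

lemma z_scale: "z (\<lambda>i. l * v i) w = l * z v w"
  by (simp add: z_def rowdot_def sum_distrib_left algebra_simps)

text \<open>The sparse \<open>L1\<close> condition, applied to the extension of \<open>v\<close> by
  zero, whose support lies in \<open>R\<close>.\<close>

lemma l1_le: "(\<Sum>i\<in>R. \<bar>v i\<bar>) \<le> \<kappa> * (\<Sum>w<D. \<bar>dot w v\<bar>)"
proof -
  define v' where "v' i = (if i \<in> R then v i else 0)" for i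
  have "card {i \<in> {..<k}. v' i \<noteq> 0} \<le> card R"
    by (intro card_mono finite_R) (auto simp: v'_def)
  then have "(\<Sum>i<k. \<bar>v' i\<bar>) / \<kappa> \<le> l1_Av k D A v'" using sparse supp_card by simp
  moreover have "(\<Sum>i<k. \<bar>v' i\<bar>) = (\<Sum>i\<in>R. \<bar>v i\<bar>)"
    using R_subset by (intro sum.mono_neutral_cong_right) (auto simp: v'_def)
  moreover have "(\<Sum>i<k. A w i * v' i) = dot w v" for w
    unfolding rowdot_def using R_subset by (intro sum.mono_neutral_cong_right) (auto simp: v'_def)
  ultimately show ?thesis using \<kappa>_pos by (simp add: l1_Av_def divide_le_eq mult.commute)
qed

text \<open>Cauchy-Schwarz after splitting \<open>\<bar>z\<bar>\<close> as
  \<open>\<bar>z\<bar> / sqrt (2 + z)\<close> times \<open>sqrt (2 + z)\<close>. The first factor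
  squares to \<open>H v\<close>; the second to \<open>2\<close>, because \<open>v\<close> sums to
  zero.\<close>

lemma dot_l1_le_H:
  assumes v: "(\<Sum>i\<in>R. v i) = 0" and low: "\<And>w. w \<in> set_pmf P \<Longrightarrow> -1/2 \<le> z v w"
  shows "(\<Sum>w<D. \<bar>dot w v\<bar>)\<^sup>2 \<le> 2 * H v"
proof -
  let ?p = "\<lambda>w. dot w xs"
  let ?a = "\<lambda>w. sqrt (?p w) * (\<bar>z v w\<bar> / sqrt (2 + z v w))"
  let ?b = "\<lambda>w. sqrt (?p w) * sqrt (2 + z v w)"
  have pos: "?p w = 0 \<or> 0 < 2 + z v w \<and> 0 < ?p w" if "w < D" for w
    using that low[of w] dot_eq_0[of w xs] by (cases "w \<in> set_pmf P") (auto simp: set_word)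
  have "\<bar>dot w v\<bar> = ?a w * ?b w" if "w < D" for w
    using pos[OF that] dot_eq[OF that, of v]
    by (auto simp: abs_mult power2_eq_square[symmetric] real_sqrt_mult_self)
  then have "(\<Sum>w<D. \<bar>dot w v\<bar>)\<^sup>2 = (\<Sum>w<D. ?a w * ?b w)\<^sup>2" by simp
  also have "\<dots> \<le> (\<Sum>w<D. (?a w)\<^sup>2) * (\<Sum>w<D. (?b w)\<^sup>2)" by (rule Cauchy_Schwarz_ineq_sum)
  also have "(\<Sum>w<D. (?a w)\<^sup>2) = H v"
    unfolding H_def expectation_word
  proof (rule sum.cong[OF refl])
    fix w assume "w \<in> {..<D}"
    then show "(?a w)\<^sup>2 = ?p w * ((z v w)\<^sup>2 / (2 + z v w))"
      using pos[of w] by (auto simp: power_mult_distrib power_divide)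
  qed
  also have "(\<Sum>w<D. (?b w)\<^sup>2) = (\<Sum>w<D. 2 * ?p w + dot w v)"
  proof (rule sum.cong[OF refl])
    fix w assume "w \<in> {..<D}"
    then show "(?b w)\<^sup>2 = 2 * ?p w + dot w v"
      using pos[of w] dot_eq[of w v] by (auto simp: power_mult_distrib algebra_simps)
  qed
  also have "\<dots> = 2" by (simp add: sum.distrib sum_dot v xs_R_sum flip: sum_distrib_left)
  finally show ?thesis by simp
qed

text \<open>Since \<open>xs i \<ge> \<tau> / r\<close>, every \<open>\<bar>v i\<bar>\<close> is at
  most \<open>xs i\<close> times the right-hand side. Averaging over row \<open>w\<close> preserves
  this, whatever the size of the entries of \<open>A\<close>.\<close>

lemma z_abs_le:
  assumes w: "w \<in> set_pmf P"
  shows "\<bar>z v w\<bar> \<le> real r / \<tau> * (\<Sum>i\<in>R. \<bar>v i\<bar>)"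
proof -
  let ?N = "\<Sum>i\<in>R. \<bar>v i\<bar>"
  have wD: "w < D" and p: "0 < dot w xs" using w by (auto simp: set_word)
  have "\<bar>dot w v\<bar> \<le> (\<Sum>i\<in>R. \<bar>A w i * v i\<bar>)" unfolding rowdot_def by (rule sum_abs)
  also have "\<dots> \<le> (\<Sum>i\<in>R. A w i * xs i * (real r / \<tau> * ?N))"
  proof (rule sum_mono)
    fix i assume i: "i \<in> R"
    have "\<bar>v i\<bar> \<le> ?N" using i finite_R by (intro member_le_sum) auto
    moreover have "1 \<le> xs i * (real r / \<tau>)" using xs_ge[OF i] \<tau>_pos r_pos by (simp add: field_simps)
    ultimately have "1 * \<bar>v i\<bar> \<le> (xs i * (real r / \<tau>)) * ?N" by (intro mult_mono) auto
    then have "A w i * \<bar>v i\<bar> \<le> A w i * ((xs i * (real r / \<tau>)) * ?N)"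
      using A_R_nonneg[OF wD i] by (intro mult_left_mono) auto
    then show "\<bar>A w i * v i\<bar> \<le> A w i * xs i * (real r / \<tau> * ?N)"
      using A_R_nonneg[OF wD i] by (simp add: abs_mult mult.assoc)
  qed
  also have "\<dots> = dot w xs * (real r / \<tau> * ?N)" unfolding rowdot_def by (rule sum_distrib_right[symmetric])
  finally show ?thesis using p by (simp add: z_def divide_le_eq mult.commute)
qed

text \<open>The integrands differ by the factor \<open>2 + z\<close>, which lies between
  \<open>0\<close> and \<open>2 + M\<close>.\<close>

lemma chi_square_le_H:
  assumes low: "\<And>w. w \<in> set_pmf P \<Longrightarrow> -1/2 \<le> z v w" and up: "\<And>w. w \<in> set_pmf P \<Longrightarrow> z v w \<le> M"
  shows "measure_pmf.expectation P (\<lambda>w. (z v w)\<^sup>2) \<le> (2 + M) * H v"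
proof -
  have int: "integrable P (h :: _ \<Rightarrow> real)" for h using finite_set_word by (rule integrable_measure_pmf_finite)
  have "(z v w)\<^sup>2 \<le> (2 + M) * ((z v w)\<^sup>2 / (2 + z v w))" if "w \<in> set_pmf P" for w
  proof -
    have pos: "0 < 2 + z v w" using low[OF that] by simp
    have "(2 + z v w) * ((z v w)\<^sup>2 / (2 + z v w)) \<le> (2 + M) * ((z v w)\<^sup>2 / (2 + z v w))"
      using up[OF that] pos by (intro mult_right_mono) auto
    then show ?thesis using pos by simp
  qed
  then have "measure_pmf.expectation P (\<lambda>w. (z v w)\<^sup>2)
      \<le> measure_pmf.expectation P (\<lambda>w. (2 + M) * ((z v w)\<^sup>2 / (2 + z v w)))"
    by (intro integral_mono_AE int) (simp add: AE_measure_pmf_iff)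
  also have "\<dots> = (2 + M) * H v" unfolding H_def by (rule integral_mult_right_zero)
  finally show ?thesis .
qed

text \<open>Every \<open>z v\<close> is a linear combination of the \<open>card R\<close> functions
  \<open>A w i / dot w xs\<close>, to which Gram-Schmidt with weights \<open>pmf P\<close>
  applies.\<close>

lemma z_orthonormal_span:
  obtains m :: nat and e where "m \<le> card R"
    "\<And>i j. i < m \<Longrightarrow> j < m \<Longrightarrow> measure_pmf.expectation P (\<lambda>w. e i w * e j w) = (if i = j then 1 else 0)"
    "\<And>v. \<exists>c. \<forall>w\<in>set_pmf P. z v w = (\<Sum>j<m. c j * e j w)"
proof -
  define g where "g i w = A w i / dot w xs" for i w
  have p: "0 < pmf P w" if "w \<in> set_pmf P" for w using that by (rule pmf_positive)
  from weighted_gram_schmidt[of R "set_pmf P" "pmf P" g, OF finite_R finite_set_word p]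
  obtain m e where m: "m \<le> card R"
    and on: "\<forall>i<m. \<forall>j<m. (\<Sum>w\<in>set_pmf P. pmf P w * (e i w * e j w)) = (if i = j then 1 else 0)"
    and sp: "\<forall>i\<in>R. \<exists>c. \<forall>w\<in>set_pmf P. g i w = (\<Sum>j<m. c j * e j w)" by auto
  have E: "measure_pmf.expectation P (\<lambda>w. e i w * e j w) = (\<Sum>w\<in>set_pmf P. pmf P w * (e i w * e j w))" for i j
    by (subst integral_measure_pmf[OF finite_set_word]) auto
  obtain b where b: "\<And>i w. i \<in> R \<Longrightarrow> w \<in> set_pmf P \<Longrightarrow> g i w = (\<Sum>j<m. b i j * e j w)"
    using bchoice[OF sp] by blast
  have span: "\<exists>c. \<forall>w\<in>set_pmf P. z v w = (\<Sum>j<m. c j * e j w)" for v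
  proof (intro exI ballI)
    fix w assume w: "w \<in> set_pmf P"
    have "z v w = (\<Sum>i\<in>R. v i * g i w)"
      by (simp add: z_def rowdot_def g_def sum_divide_distrib mult.commute)
    also have "\<dots> = (\<Sum>i\<in>R. \<Sum>j<m. v i * b i j * e j w)"
      by (intro sum.cong refl) (simp add: b w sum_distrib_left mult.assoc)
    also have "\<dots> = (\<Sum>j<m. (\<Sum>i\<in>R. v i * b i j) * e j w)"
      by (subst sum.swap) (simp add: sum_distrib_right)
    finally show "z v w = (\<Sum>j<m. (\<Sum>i\<in>R. v i * b i j) * e j w)" .
  qed
  show ?thesis by (rule that[of m e]) (use m on span E in auto)
qed

section \<open>Localization of the maximizer\<close>

lemma xs_simplex: "xs \<in> simplex_on R"
  using xs_pos xs_R_sum xs_outside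
  by (auto simp: simplex_on_def less_imp_le supp_k_def not_less)

lemma dot_half_diff: "dot w (\<lambda>i. (x i - y i) / 2) = (dot w x - dot w y) / 2"
  by (simp add: rowdot_def sum_divide_distrib right_diff_distrib diff_divide_distrib sum_subtractf)

text \<open>The value is half of a likelihood ratio minus one, and the ratio is nonnegative.\<close>

lemma z_half_diff_ge:
  assumes x: "x \<in> simplex_on R" and w: "w \<in> set_pmf P"
  shows "-1/2 \<le> z (\<lambda>i. (x i - xs i) / 2) w"
proof -
  have "0 \<le> dot w x" unfolding rowdot_def using w x A_R_nonneg
    by (intro sum_nonneg mult_nonneg_nonneg) (auto simp: simplex_on_def set_word)
  then show ?thesis using w by (simp add: z_def dot_half_diff set_word field_simps)
qed

text \<open>Halving the deviation keeps the likelihood ratios above \<open>1/2\<close>; by concavity of the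
  log-likelihood every point of the segment from \<open>xs\<close> to the maximizer is at least as likely
  as \<open>xs\<close>, so the segment can be cut where \<open>H\<close> takes the prescribed value.\<close>

lemma MLE_localize:
  assumes ws: "\<And>t. t < n \<Longrightarrow> ws t \<in> set_pmf P" and x: "is_MLE A R n ws x"
    and h: "0 \<le> h" "h < H (\<lambda>i. (x i - xs i) / 2)"
  shows "\<exists>u. (\<Sum>i\<in>R. u i) = 0 \<and> (\<forall>w\<in>set_pmf P. -1/2 \<le> z u w) \<and> H u = h \<and>
    0 \<le> (\<Sum>t<n. ln (1 + z u (ws t)))"
proof -
  define v where "v i = (x i - xs i) / 2" for i
  have xD: "x \<in> simplex_on R" and xf: "finite_loglik A R n ws x"
    and xm: "\<And>y. y \<in> simplex_on R \<Longrightarrow> finite_loglik A R n ws y \<Longrightarrow> loglik A R n ws y \<le> loglik A R n ws x"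
    using x by (auto simp: is_MLE_def)
  have zv: "z v w = (dot w x / dot w xs - 1) / 2" if "w \<in> set_pmf P" for w
    using that by (simp add: z_def v_def[abs_def] dot_half_diff set_word field_simps)
  have low: "-1/2 \<le> z v w" if "w \<in> set_pmf P" for w
    using z_half_diff_ge[OF xD that] by (simp add: v_def[abs_def])
  have lowl: "-1/2 \<le> l * z v w" if "w \<in> set_pmf P" "0 \<le> l" "l \<le> 1" for l w
  proof -
    have "l * (-1/2) \<le> l * z v w" using low[OF that(1)] that by (intro mult_left_mono) auto
    then show ?thesis using that by linarith
  qed
  define F where "F l = H (\<lambda>i. l * v i)" for l
  have F: "F l = (\<Sum>w<D. dot w xs * ((l * z v w)\<^sup>2 / (2 + l * z v w)))" for l
    by (simp add: F_def H_def expectation_word z_scale)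
  \<comment> \<open>The denominators stay positive on the support of \<open>P\<close>; elsewhere the
    weight \<open>dot w xs\<close> is zero. The intermediate value theorem then cuts the segment
    where \<open>F\<close> equals \<open>h\<close>.\<close>
  have "continuous_on {0..1} F"
    unfolding F
  proof (rule continuous_on_sum)
    fix w assume "w \<in> {..<D}"
    show "continuous_on {0..1} (\<lambda>l. dot w xs * ((l * z v w)\<^sup>2 / (2 + l * z v w)))"
    proof (cases "w \<in> set_pmf P")
      case True
      have "2 + l * z v w \<noteq> 0" if "l \<in> {0..1}" for l using lowl[OF True, of l] that by auto
      then show ?thesis by (intro continuous_intros) auto
    next
      case False
      then show ?thesis using dot_eq_0[of w xs] \<open>w \<in> {..<D}\<close> by simp
    qed
  qed
  moreover have "F 0 \<le> h" "h \<le> F 1" using h by (simp add: F) (simp add: F_def v_def h(2) less_imp_le)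
  ultimately obtain l where l: "0 \<le> l" "l \<le> 1" "F l = h" using IVT'[of F 0 h 1] by auto
  define u where "u i = l * v i" for i
  have zu: "z u w = l * z v w" for w unfolding u_def by (rule z_scale)
  have "(\<Sum>i\<in>R. u i) = 0"
    using xD xs_R_sum by (simp add: u_def v_def simplex_on_def sum_subtractf flip: sum_distrib_left sum_divide_distrib)
  moreover have "\<forall>w\<in>set_pmf P. -1/2 \<le> z u w" using lowl l by (simp add: zu)
  moreover have "H u = h" using l(3) by (simp add: F_def u_def[abs_def])
  moreover have "0 \<le> (\<Sum>t<n. ln (1 + z u (ws t)))"
  proof -
    have xsf: "finite_loglik A R n ws xs" using ws by (simp add: finite_loglik_def set_word)
    have "loglik A R n ws xs \<le> loglik A R n ws x" by (rule xm[OF xs_simplex xsf])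
    then have "0 \<le> (\<Sum>t<n. ln (dot (ws t) x) - ln (dot (ws t) xs))"
      by (simp add: loglik_def sum_subtractf)
    \<comment> \<open>The weight is \<open>l / 2\<close> and not \<open>l\<close>: \<open>v\<close>
      is already half of the deviation, so \<open>1 + z u\<close> mixes \<open>1\<close> and the
      likelihood ratio of \<open>x\<close> with weight \<open>l / 2\<close>.\<close>
    then have "0 \<le> l / 2 * (\<Sum>t<n. ln (dot (ws t) x) - ln (dot (ws t) xs))" using l by simp
    also have "\<dots> = (\<Sum>t<n. l / 2 * (ln (dot (ws t) x) - ln (dot (ws t) xs)))" by (rule sum_distrib_left)
    also have "\<dots> \<le> (\<Sum>t<n. ln (1 + z u (ws t)))"
    proof (rule sum_mono)
      fix t assume "t \<in> {..<n}"
      then have t: "t < n" by simp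
      have q: "0 < dot (ws t) x" and p: "0 < dot (ws t) xs" using xf xsf t by (auto simp: finite_loglik_def)
      have "l / 2 * ln (dot (ws t) x / dot (ws t) xs) \<le> ln (1 - l / 2 + l / 2 * (dot (ws t) x / dot (ws t) xs))"
        using q p l by (intro ln_convex_combination_ge) auto
      also have "1 - l / 2 + l / 2 * (dot (ws t) x / dot (ws t) xs) = 1 + z u (ws t)"
        by (simp add: zu zv[OF ws[OF t]] field_simps)
      finally show "l / 2 * (ln (dot (ws t) x) - ln (dot (ws t) xs)) \<le> ln (1 + z u (ws t))"
        using p q by (simp add: ln_div)
    qed
    finally show ?thesis .
  qed
  ultimately show ?thesis by blast
qed

section \<open>Error bounds with explicit constants\<close>

text \<open>The shell bound is applied with \<open>Q = k\<close> and \<open>L = ln k\<close>;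
  \<open>3 \<le> k\<close> ensures \<open>1 \<le> ln k\<close>. The exponent \<open>1\<close> is
  written out to match the general power in the final statement.\<close>

theorem MLE_error_prob:
  assumes k: "3 \<le> k" and n: "208 * \<kappa>\<^sup>2 * (real r)\<^sup>2 * ln (real k) / \<tau>\<^sup>2 \<le> real n"
  shows "1 - (2 / ln (real k) + 1 / real k) \<le> measure_pmf.prob (doc_pmf n P)
     {ws. \<forall>x. is_MLE A R n ws x \<longrightarrow>
        (\<Sum>w<D. \<bar>dot w x - dot w xs\<bar>) \<le> 29 * (1 + ln (real k)) ^ 1 * sqrt (real r / real n) \<and>
        (\<Sum>i\<in>R. \<bar>x i - xs i\<bar>) \<le> 29 * (1 + ln (real k)) ^ 1 * \<kappa> * sqrt (real r / real n)}"
    (is "_ \<le> measure_pmf.prob _ ?G")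
proof -
  define L where "L = ln (real k)"
  define s where "s = real (card R)"
  have L: "1 \<le> L"
  proof -
    have "exp 1 \<le> real k" using exp_le k by linarith
    then show ?thesis unfolding L_def using k by (subst ln_ge_iff) auto
  qed
  have Lk: "L \<le> real k" unfolding L_def using k ln_le_minus_one[of "real k"] by simp
  have s1: "1 \<le> s" and sk: "s \<le> real k" and sr: "s \<le> real r"
    using card_R_pos card_R_le supp_card by (auto simp: s_def)
  have pos: "0 < \<kappa>\<^sup>2 * (real r)\<^sup>2 / \<tau>\<^sup>2" using \<kappa>_pos r_pos \<tau>_pos by simp
  have n': "208 * (\<kappa>\<^sup>2 * (real r)\<^sup>2 / \<tau>\<^sup>2) * L \<le> real n" using n by (simp add: L_def)
  have "0 < 208 * (\<kappa>\<^sup>2 * (real r)\<^sup>2 / \<tau>\<^sup>2) * L" using pos L by (intro mult_pos_pos) auto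
  then have n0: "0 < real n" using n' by linarith
  \<comment> \<open>\<open>104 = 8 * 13\<close>: the Chernoff factor becomes
    \<open>exp (- 13 * s * L)\<close>, which beats a net of at most \<open>exp (12 * s * L)\<close>
    points and leaves \<open>exp (- s * L) \<le> 1 / k\<close>.\<close>
  define \<rho> where "\<rho> = sqrt (104 * s * L / real n)"
  have \<rho>2: "\<rho>\<^sup>2 = 104 * s * L / real n" using s1 L by (simp add: \<rho>_def)
  have \<rho>0: "0 < \<rho>" using s1 L n0 by (simp add: \<rho>_def)
  have n\<rho>: "real n * \<rho>\<^sup>2 = 104 * s * L" using n0 by (simp add: \<rho>2)
  define U where "U = {u. (\<Sum>i\<in>R. u i) = 0 \<and> (\<forall>w\<in>set_pmf P. -1/2 \<le> z u w) \<and> H u = \<rho>\<^sup>2}"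
  \<comment> \<open>Stated for \<open>H u \<le> \<rho>^2\<close> because it serves both the shell
    \<open>U\<close> and, at the end, the halved deviation of the maximizer.\<close>
  have l1U: "(\<Sum>w<D. \<bar>dot w u\<bar>) \<le> sqrt 2 * \<rho>"
    if "(\<Sum>i\<in>R. u i) = 0" "\<And>w. w \<in> set_pmf P \<Longrightarrow> -1/2 \<le> z u w" "H u \<le> \<rho>\<^sup>2" for u
  proof -
    have "(\<Sum>w<D. \<bar>dot w u\<bar>)\<^sup>2 \<le> (sqrt 2 * \<rho>)\<^sup>2"
      using dot_l1_le_H[OF that(1,2)] that(3) by (simp add: power_mult_distrib)
    then show ?thesis by (rule power2_le_imp_le) (use \<rho>0 in simp)
  qed
  have chiU: "measure_pmf.expectation P (\<lambda>w. (z u w)\<^sup>2) \<le> (real k * \<rho>)\<^sup>2" if u: "u \<in> U" for u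
  proof -
    have u': "(\<Sum>i\<in>R. u i) = 0" "\<And>w. w \<in> set_pmf P \<Longrightarrow> -1/2 \<le> z u w" "H u = \<rho>\<^sup>2"
      using u by (auto simp: U_def)
    \<comment> \<open>A pointwise bound for \<open>\<bar>z u\<bar>\<close> on the shell:
      \<open>z_abs_le\<close>, then \<open>l1_le\<close>, then \<open>l1U\<close>. Its square
      contains \<open>2 * 104 = 208\<close>, the constant in the lower bound on \<open>n\<close>,
      which therefore gives \<open>M^2 \<le> s \<le> k^2\<close>.\<close>
    define M where "M = real r / \<tau> * (\<kappa> * (sqrt 2 * \<rho>))"
    have "M\<^sup>2 = 208 * (\<kappa>\<^sup>2 * (real r)\<^sup>2 / \<tau>\<^sup>2) * L / real n * s"
      unfolding M_def by (simp add: power_mult_distrib power_divide \<rho>2 algebra_simps)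
    also have "\<dots> \<le> 1 * s" using n' s1 by (intro mult_right_mono) (simp_all only: divide_le_eq_1_pos[OF n0])
    also have "\<dots> \<le> (real k)\<^sup>2" using sk s1 mult_mono[of 1 "real k" s "real k"] by (simp add: power2_eq_square)
    finally have Mk: "M \<le> real k" by (rule power2_le_imp_le) simp
    have "z u w \<le> M" if "w \<in> set_pmf P" for w
    proof -
      have "\<bar>z u w\<bar> \<le> real r / \<tau> * (\<Sum>i\<in>R. \<bar>u i\<bar>)" by (rule z_abs_le[OF that])
      also have "\<dots> \<le> real r / \<tau> * (\<kappa> * (\<Sum>w<D. \<bar>dot w u\<bar>))"
        using \<tau>_pos by (intro mult_left_mono l1_le) auto
      also have "\<dots> \<le> M" unfolding M_def
        using \<tau>_pos \<kappa>_pos l1U[OF u'(1,2)] u'(3) by (intro mult_left_mono) auto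
      finally show ?thesis by simp
    qed
    then have "measure_pmf.expectation P (\<lambda>w. (z u w)\<^sup>2) \<le> (2 + M) * H u"
      by (intro chi_square_le_H u'(2))
    also have "\<dots> \<le> (real k)\<^sup>2 * \<rho>\<^sup>2"
      unfolding u'(3)
    proof (rule mult_right_mono)
      have "2 + M \<le> 3 * real k" using Mk k by simp
      also have "\<dots> \<le> real k * real k" using k by (intro mult_right_mono) auto
      finally show "2 + M \<le> (real k)\<^sup>2" by (simp add: power2_eq_square)
    qed simp
    finally show ?thesis by (simp add: power_mult_distrib)
  qed
  obtain m e where m: "m \<le> card R"
    and on: "\<And>i j. i < m \<Longrightarrow> j < m \<Longrightarrow> measure_pmf.expectation P (\<lambda>w. e i w * e j w) = (if i = j then 1 else 0)"
    and sp: "\<And>v. \<exists>c. \<forall>w\<in>set_pmf P. z v w = (\<Sum>j<m. c j * e j w)"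
    by (rule z_orthonormal_span) (rule that)
  define Bad where "Bad = {ws. \<exists>y\<in>z ` U. 0 \<le> (\<Sum>t<n. ln (1 + y (ws t)))}"
  have "measure_pmf.prob (doc_pmf n P) Bad
      \<le> 2 / L + (64 * s\<^sup>2 * L * (real k)\<^sup>2 + 2) ^ m * exp (- (real n * \<rho>\<^sup>2 / 8))"
    unfolding doc_pmf_def Bad_def
  proof (rule localized_loglik_ratio_prob[OF finite_set_word on])
    show "s * L \<le> real n * \<rho>\<^sup>2" unfolding n\<rho> using s1 L by simp
    show "real m \<le> s" using m by (simp add: s_def)
    show "measure_pmf.expectation P y = 0" if "y \<in> z ` U" for y
      using that by (auto simp: U_def expectation_z)
    show "measure_pmf.expectation P (\<lambda>w. (y w)\<^sup>2 / (2 + y w)) = \<rho>\<^sup>2" if "y \<in> z ` U" for y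
      using that by (auto simp: U_def H_def)
  qed (use sp chiU s1 L k \<rho>0 in \<open>auto simp: U_def\<close>)
  also have "(64 * s\<^sup>2 * L * (real k)\<^sup>2 + 2) ^ m * exp (- (real n * \<rho>\<^sup>2 / 8)) \<le> 1 / real k"
  proof -
    have "s\<^sup>2 * L * (real k)\<^sup>2 \<le> (real k)\<^sup>2 * real k * (real k)\<^sup>2"
      using s1 sk L Lk by (intro mult_mono power_mono) auto
    also have "\<dots> = real k ^ 5" by (simp add: power2_eq_square eval_nat_numeral)
    finally have "64 * s\<^sup>2 * L * (real k)\<^sup>2 + 2 \<le> 64 * real k ^ 5 + 2" by simp
    also have "\<dots> \<le> 66 * real k ^ 5" using k one_le_power[of "real k" 5] by simp
    \<comment> \<open>\<open>66 \<le> 3 ^ 7\<close>, so the numerical constant is absorbed into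
      powers of \<open>k\<close>.\<close>
    also have "\<dots> \<le> real k ^ 7 * real k ^ 5"
      using k power_mono[of 3 "real k" 7] by (intro mult_right_mono) auto
    also have "\<dots> = real k ^ 12" by (simp flip: power_add)
    finally have "(64 * s\<^sup>2 * L * (real k)\<^sup>2 + 2) ^ m \<le> (real k ^ 12) ^ m"
      using L by (intro power_mono) auto
    also have "\<dots> \<le> (real k ^ 12) ^ card R" using k m by (intro power_increasing) auto
    also have "\<dots> = exp (12 * s * L)"
    proof -
      have "real k = exp L" using k by (simp add: L_def)
      then show ?thesis by (simp add: s_def algebra_simps flip: exp_of_nat_mult power_mult)
    qed
    finally have "(64 * s\<^sup>2 * L * (real k)\<^sup>2 + 2) ^ m * exp (- (real n * \<rho>\<^sup>2 / 8))
        \<le> exp (12 * s * L) * exp (- (13 * s * L))" unfolding n\<rho> by (intro mult_mono) auto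
    also have "\<dots> = exp (- (s * L))" by (simp flip: exp_add)
    also have "\<dots> \<le> exp (- L)" using s1 L by simp
    also have "\<dots> = 1 / real k" using k by (simp add: L_def exp_minus inverse_eq_divide)
    finally show ?thesis .
  qed
  finally have bad: "measure_pmf.prob (doc_pmf n P) Bad \<le> 2 / L + 1 / real k" by simp
  have good: "ws \<in> ?G" if wsM: "ws \<in> set_pmf (doc_pmf n P)" and nb: "ws \<notin> Bad" for ws
  proof (clarify)
    fix x assume x: "is_MLE A R n ws x"
    have ws: "ws t \<in> set_pmf P" if "t < n" for t
      using wsM that by (auto simp: doc_pmf_def set_Pi_pmf PiE_dflt_def)
    define v where "v i = (x i - xs i) / 2" for i
    \<comment> \<open>Otherwise the segment from \<open>xs\<close> would cross the shell at a point
      at least as likely as \<open>xs\<close>, and such a point is what \<open>Bad\<close>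
      records.\<close>
    have "\<not> \<rho>\<^sup>2 < H v"
    proof
      assume "\<rho>\<^sup>2 < H v"
      then obtain u where "u \<in> U" "0 \<le> (\<Sum>t<n. ln (1 + z u (ws t)))"
        using MLE_localize[OF ws x, of "\<rho>\<^sup>2"] by (auto simp: U_def v_def[abs_def])
      then show False using nb by (auto simp: Bad_def)
    qed
    then have Hv: "H v \<le> \<rho>\<^sup>2" by simp
    have xD: "x \<in> simplex_on R" using x by (simp add: is_MLE_def)
    have v0: "(\<Sum>i\<in>R. v i) = 0"
      using xD xs_R_sum by (simp add: v_def simplex_on_def sum_subtractf flip: sum_divide_distrib)
    have low: "-1/2 \<le> z v w" if "w \<in> set_pmf P" for w
      using z_half_diff_ge[OF xD that] by (simp add: v_def[abs_def])
    \<comment> \<open>The factor \<open>2\<close> undoes the halving. It leads to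
      \<open>832 = 4 * 2 * 104\<close>, and \<open>832 \<le> 29 ^ 2\<close>.\<close>
    have "(\<Sum>w<D. \<bar>dot w x - dot w xs\<bar>) = 2 * (\<Sum>w<D. \<bar>dot w v\<bar>)"
      by (simp add: v_def[abs_def] dot_half_diff sum_distrib_left)
    also have "\<dots> \<le> 2 * (sqrt 2 * \<rho>)" using l1U[OF v0 low Hv] by simp
    also have "\<dots> = sqrt 832 * sqrt L * sqrt (s / real n)"
    proof -
      have "2 * (sqrt 2 * \<rho>) = sqrt 4 * (sqrt 2 * \<rho>)" by simp
      also have "\<dots> = sqrt (832 * L * (s / real n))"
        unfolding \<rho>_def real_sqrt_mult[symmetric] by (simp add: algebra_simps)
      finally show ?thesis by (simp only: real_sqrt_mult)
    qed
    also have "\<dots> \<le> 29 * (1 + L) * sqrt (real r / real n)"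
    proof (intro mult_mono)
      show "sqrt 832 \<le> 29" by (rule real_le_lsqrt) auto
      have "L \<le> (1 + L)\<^sup>2" using L by (simp add: power2_eq_square algebra_simps)
      then show "sqrt L \<le> 1 + L" using L by (intro real_le_lsqrt) auto
      show "sqrt (s / real n) \<le> sqrt (real r / real n)" using sr by (simp add: divide_right_mono)
    qed (use L s1 in auto)
    finally have first: "(\<Sum>w<D. \<bar>dot w x - dot w xs\<bar>) \<le> 29 * (1 + L) * sqrt (real r / real n)" .
    have "(\<Sum>i\<in>R. \<bar>x i - xs i\<bar>) \<le> \<kappa> * (\<Sum>w<D. \<bar>dot w (\<lambda>i. x i - xs i)\<bar>)" by (rule l1_le)
    also have "(\<Sum>w<D. \<bar>dot w (\<lambda>i. x i - xs i)\<bar>) = (\<Sum>w<D. \<bar>dot w x - dot w xs\<bar>)"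
      by (simp add: rowdot_def right_diff_distrib sum_subtractf)
    also have "\<kappa> * \<dots> \<le> \<kappa> * (29 * (1 + L) * sqrt (real r / real n))"
      using first \<kappa>_pos by (intro mult_left_mono) auto
    finally have "(\<Sum>i\<in>R. \<bar>x i - xs i\<bar>) \<le> 29 * (1 + L) * \<kappa> * sqrt (real r / real n)" by (simp add: mult_ac)
    with first show "(\<Sum>w<D. \<bar>dot w x - dot w xs\<bar>) \<le> 29 * (1 + ln (real k)) ^ 1 * sqrt (real r / real n) \<and>
        (\<Sum>i\<in>R. \<bar>x i - xs i\<bar>) \<le> 29 * (1 + ln (real k)) ^ 1 * \<kappa> * sqrt (real r / real n)"
      by (simp add: L_def)
  qed
  have "1 - (2 / L + 1 / real k) \<le> 1 - measure_pmf.prob (doc_pmf n P) Bad" using bad by simp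
  also have "\<dots> = measure_pmf.prob (doc_pmf n P) (- Bad)"
    using measure_pmf.prob_compl[of Bad "doc_pmf n P"] by (simp add: Compl_eq_Diff_UNIV)
  also have "\<dots> \<le> measure_pmf.prob (doc_pmf n P) ?G"
    using good by (intro measure_pmf.finite_measure_mono_AE) (auto simp: AE_measure_pmf_iff)
  finally show ?thesis by (simp add: L_def)
qed

end

section \<open>Absolute constants and small \<open>k\<close>\<close>

text \<open>The quantifier order encodes the asymptotic wording: \<open>c\<close>, \<open>C\<close>
  and \<open>p\<close> are absolute, and \<open>\<delta>\<close> depends on \<open>k\<close> alone.
  Bounding every maximizer avoids any appeal to uniqueness.\<close>

theorem theorem5p1:
  shows "\<exists>c>0. \<exists>C>0. \<exists>p::nat. \<exists>\<delta>::nat \<Rightarrow> real. \<delta> \<longlonglongrightarrow> 0 \<and>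
    (\<forall>(k::nat) (D::nat) (A::nat \<Rightarrow> nat \<Rightarrow> real) (xs::nat \<Rightarrow> real) (r::nat) (\<tau>::real) (\<kappa>::real) (n::nat).
      (\<forall>w<D. \<forall>i<k. 0 \<le> A w i) \<and> (\<forall>i<k. (\<Sum>w<D. A w i) = 1) \<and>
      (\<forall>i<k. 0 \<le> xs i) \<and> (\<forall>i. k \<le> i \<longrightarrow> xs i = 0) \<and> (\<Sum>i<k. xs i) = 1 \<and>
      0 < \<tau> \<and> \<tau> \<le> 1 \<and>
      card (supp_k k xs) \<le> r \<and> (\<forall>i\<in>supp_k k xs. \<tau> / real r \<le> xs i) \<and>
      0 < \<kappa> \<and>
      (\<forall>v::nat \<Rightarrow> real. card {i\<in>{..<k}. v i \<noteq> 0} \<le> r \<longrightarrow>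
          (\<Sum>i<k. \<bar>v i\<bar>) / \<kappa> \<le> l1_Av k D A v) \<and>
      c * \<kappa>^2 * (real r)^2 * ln (real k) / \<tau>^2 \<le> real n
      \<longrightarrow>
      measure_pmf.prob (doc_pmf n (word_pmf k D A xs))
        {ws. \<forall>x. is_MLE A (supp_k k xs) n ws x \<longrightarrow>
           (\<Sum>w<D. \<bar>rowdot A (supp_k k xs) w x - rowdot A (supp_k k xs) w xs\<bar>)
              \<le> C * (1 + ln (real k))^p * sqrt (real r / real n) \<and>
           (\<Sum>i\<in>supp_k k xs. \<bar>x i - xs i\<bar>)
              \<le> C * (1 + ln (real k))^p * \<kappa> * sqrt (real r / real n)}
      \<ge> 1 - \<delta> k)"
proof (rule exI[of _ "208::real"], rule conjI, simp, rule exI[of _ "29::real"], rule conjI, simp,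
    rule exI[of _ "1::nat"], rule exI[of _ "\<lambda>k. 2 / ln (real k) + 1 / real k"],
    intro conjI allI impI, goal_cases)
  case 1
  have "filterlim (\<lambda>k. ln (real k)) at_top sequentially"
    by (rule filterlim_compose[OF ln_at_top filterlim_real_sequentially])
  from tendsto_add[OF tendsto_divide_0[OF tendsto_const filterlim_at_top_imp_at_infinity[OF this]] lim_1_over_n, of 2]
  show ?case by simp
next
  case (2 k D A xs r \<tau> \<kappa> n)
  then interpret topic_model k D A xs r \<tau> \<kappa>
    by unfold_locales auto
  show ?case
  proof (cases "3 \<le> k")
    case True
    then show ?thesis using 2 by (intro MLE_error_prob) auto
  next
    \<comment> \<open>For \<open>k < 3\<close> the claim is trivial, as the allowed failure
      probability is at least \<open>1\<close>. At \<open>k = 1\<close> this relies on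
      \<open>2 / ln 1 = 2 / 0 = 0\<close> together with \<open>1 / k = 1\<close>;
      \<open>k = 0\<close> is excluded because the support is nonempty.\<close>
    case False
    have "k \<noteq> 0" using card_R_pos card_R_le by auto
    with False consider "k = 1" | "k = 2" by linarith
    then have "1 \<le> 2 / ln (real k) + 1 / real k"
    proof cases
      case 2
      have "ln (2::real) \<le> 1" using ln_le_minus_one[of "2::real"] by simp
      then show ?thesis using 2 by (simp add: field_simps)
    qed simp
    then show ?thesis by (meson diff_le_0_iff_le measure_nonneg order_trans)
  qed
qed

end
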